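(* Let $F(x,y,z)=(A(x,y),g(z+r(x)))$ on $\mathbb T^2\times\mathbb T$ with $A,g,r$ as in the context, satisfying assumptions (A1)-(A3) stated in the context. Then there is a $DF$-invariant continuous splitting of the tangent bundle of $\mathbb T^2\times\mathbb T$ into $E^u\oplus E^c\oplus E^s$ and a constant $c_0>0$ such that: (i) $E^c=\langle\partial_z\rangle$, and for $v\in E^c$, $\lambda_g^{min}\|v\|\le\|DFv\|\le\lambda_g^{max}\|v\|$; (ii) for all $v\in E^u$, $\|DF^nv\|\ge c_0(\lambda_A)^{-n}\|v\|$ for all $n\ge0$; and for all $v\in E^s$, $\|DF^nv\|\le c_0^{-1}(\lambda_A)^n\|v\|$ for all $n\ge0$.
   Context: $\mathbb T=\mathbb R/\mathbb Z$; $\partial_x,\partial_y,\partial_z$ are the unit coordinate vectors, and $\langle\partial_z\rangle$ is the subspace spanned by $\partial_z$. The map $A$: $A:\mathbb T^2\to\mathbb T^2$ is a $C^2$ Anosov diffeomorphism with $DA$-invariant splitting $T_{\mathrm p}\mathbb T^2=E^s_A(\mathrm p)\oplus E^u_A(\mathrm p)$ into one-dimensional subspaces, and there is $\lambda_A<1$ such that for all $\mathrm p\in\mathbb T^2$, $\|DA_{\mathrm p}w\|\le\lambda_A\|w\|$ for $w\in E^s_A(\mathrm p)$ and $\|D(A^{-1})_{\mathrm p}v\|\le\lambda_A\|v\|$ for $v\in E^u_A(\mathrm p)$. The map $g$: $g:\mathbb T\to\mathbb T$ is a $C^2$ map with $g'>0$ (orientation-preserving diffeomorphism) with exactly two fixed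 points, a repelling one $z_r$ and an attracting one $z_a$; for all $z\in\mathbb T\setminus\{z_a,z_r\}$, $g^nz\to z_a$ and $g^{-n}z\to z_r$ as $n\to\infty$; and $\lambda_g^{max}:=\max g'=g'(z_r)$, $\lambda_g^{min}:=\min g'=g'(z_a)$. The map $r:\mathbb T\to\mathbb T$ is an orientation-preserving diffeomorphism. Assumptions: (A1) $\lambda_A<\lambda_g^{min}<1<\lambda_g^{max}<(\lambda_A)^{-1}$. (A2) $r$ is $C^2$ with $c\le r'\le C$ for some $c,C>0$. (A3) (i) $E^u_A(\mathrm p)$ and $E^s_A(\mathrm p)$ are nowhere aligned with the $y$-axis. Let $\partial^u_A(\mathrm p)$ be the unit vector in $E^u_A(\mathrm p)$ with positive $x$-component and $\partial^s_A(\mathrm p)$ the unit vector in $E^s_A(\mathrm p)$ with negative $x$-component; $\beta>0$ is such that $\partial^u_A(\mathrm p)\cdot\partial_x\ge\beta$ and $\partial^s_A(\mathrm p)\cdot\partial_x\le-\beta$ for all $\mathrm p\in\mathbb T^2$. (ii) Let $\alpha^u,\alpha^s$ be the functions on $\mathbb T^2$ with $DA_{\mathrm p}(\partial^u_A(\mathrm p))=\alpha^u(\mathrm p)\partial^u_A(A\mathrm p)$ and $DA_{\mathrm p}(\partial^s_A(\mathrm p))=\alpha^s(\mathrm p)\partial^s_A(A\mathrm p)$; assume $\alpha^u,\alpha^s>0$. *)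

theory Defs
  imports "HOL-Analysis.Analysis"
begin

definition cong_Z :: "real \<Rightarrow> real \<Rightarrow> bool" where
  "cong_Z x y \<longleftrightarrow> x - y \<in> \<int>"

lemma equivp_cong_Z: "equivp cong_Z"
proof (rule equivpI)
  show "reflp cong_Z" by (simp add: reflp_def cong_Z_def)
  show "symp cong_Z"
    by (metis Ints_minus cong_Z_def minus_diff_eq sympI)
  show "transp cong_Z"
  proof (rule transpI)
    fix x y z assume "cong_Z x y" "cong_Z y z"
    then have "(x - y) + (y - z) \<in> \<int>" unfolding cong_Z_def by (rule Ints_add)
    then show "cong_Z x z" by (simp add: cong_Z_def)
  qed
qed

quotient_type circle = real / cong_Z
  morphisms rep_circle proj1
  by (rule equivp_cong_Z)

instantiation circle :: ab_group_add
begin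

lift_definition zero_circle :: circle is "0" .

lift_definition plus_circle :: "circle \<Rightarrow> circle \<Rightarrow> circle" is "(+)"
  unfolding cong_Z_def by (metis Ints_add add_diff_add)

lift_definition minus_circle :: "circle \<Rightarrow> circle \<Rightarrow> circle" is "(-)"
  unfolding cong_Z_def by (metis Ints_diff diff_diff_eq2 diff_diff_add add_diff_eq add.commute diff_add_eq)

lift_definition uminus_circle :: "circle \<Rightarrow> circle" is "uminus"
  unfolding cong_Z_def by (metis Ints_minus minus_diff_minus)

instance
  by standard (transfer; simp add: cong_Z_def)+

end

instantiation circle :: topological_space
begin

definition open_circle :: "circle set \<Rightarrow> bool" where
  "open_circle U \<longleftrightarrow> open (proj1 -` U)"

instance
  by standard (auto simp: open_circle_def vimage_Union)

end

type_synonym torus2 = "circle \<times> circle"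
type_synonym torus3 = "torus2 \<times> circle"

text \<open>
  Universal coverings. All tangent spaces are identified with the covering vector space by
  translation, so a field of subspaces of the tangent bundle of the 3-torus is a function
  \<open>torus3 \<Rightarrow> ((real \<times> real) \<times> real) set\<close>. The library norm on products of reals is the
  Euclidean norm.
\<close>

definition proj2 :: "real \<times> real \<Rightarrow> torus2" where
  "proj2 = map_prod proj1 proj1"

definition proj3 :: "(real \<times> real) \<times> real \<Rightarrow> torus3" where
  "proj3 = map_prod proj2 proj1"

text \<open>
  Derivatives of maps between tori, computed in the charts given by local inverses of the
  coverings \<open>\<pi>\<close> (source) and \<open>\<rho>\<close> (target), that is, on local lifts of the map.
  A map has at most one derivative at a point: two local lifts that are continuous at
  \<open>x\<close> differ near \<open>x\<close> by a constant integer vector, and changing \<open>x\<close> in its fibre amounts to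
  precomposing with an integer translation.
\<close>

definition has_torus_derivative ::
  "('a::real_normed_vector \<Rightarrow> 'm) \<Rightarrow> ('b::real_normed_vector \<Rightarrow> 'n) \<Rightarrow>
   ('m \<Rightarrow> 'n) \<Rightarrow> ('a \<Rightarrow> 'b) \<Rightarrow> 'm \<Rightarrow> bool" where
  "has_torus_derivative \<pi> \<rho> f L p \<longleftrightarrow>
    (\<exists>x h. \<pi> x = p \<and> (\<forall>\<^sub>F y in nhds x. \<rho> (h y) = f (\<pi> y)) \<and> (h has_derivative L) (at x))"

definition torus_derivative ::
  "('a::real_normed_vector \<Rightarrow> 'm) \<Rightarrow> ('b::real_normed_vector \<Rightarrow> 'n) \<Rightarrow>
   ('m \<Rightarrow> 'n) \<Rightarrow> 'm \<Rightarrow> 'a \<Rightarrow> 'b" where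
  "torus_derivative \<pi> \<rho> f p = (SOME L. has_torus_derivative \<pi> \<rho> f L p)"

abbreviation D2 :: "(torus2 \<Rightarrow> torus2) \<Rightarrow> torus2 \<Rightarrow> real \<times> real \<Rightarrow> real \<times> real" where
  "D2 \<equiv> torus_derivative proj2 proj2"

abbreviation D3 ::
  "(torus3 \<Rightarrow> torus3) \<Rightarrow> torus3 \<Rightarrow> (real \<times> real) \<times> real \<Rightarrow> (real \<times> real) \<times> real" where
  "D3 \<equiv> torus_derivative proj3 proj3"

definition circle_deriv :: "(circle \<Rightarrow> circle) \<Rightarrow> circle \<Rightarrow> real" where
  "circle_deriv f p = torus_derivative proj1 proj1 f p 1"

definition C1_on :: "'a::real_normed_vector set \<Rightarrow> ('a \<Rightarrow> 'b::real_normed_vector) \<Rightarrow> bool" where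
  "C1_on U h \<longleftrightarrow>
    (\<exists>h' :: 'a \<Rightarrow> 'a \<Rightarrow>\<^sub>L 'b.
      (\<forall>x\<in>U. (h has_derivative blinfun_apply (h' x)) (at x)) \<and> continuous_on U h')"

definition C2_on :: "'a::real_normed_vector set \<Rightarrow> ('a \<Rightarrow> 'b::real_normed_vector) \<Rightarrow> bool" where
  "C2_on U h \<longleftrightarrow>
    (\<exists>h' :: 'a \<Rightarrow> 'a \<Rightarrow>\<^sub>L 'b.
      (\<forall>x\<in>U. (h has_derivative blinfun_apply (h' x)) (at x)) \<and> C1_on U h')"

definition torus_C1 ::
  "('a::real_normed_vector \<Rightarrow> 'm) \<Rightarrow> ('b::real_normed_vector \<Rightarrow> 'n) \<Rightarrow> ('m \<Rightarrow> 'n) \<Rightarrow> bool" where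
  "torus_C1 \<pi> \<rho> f \<longleftrightarrow>
    (\<forall>x. \<exists>U h. open U \<and> x \<in> U \<and> (\<forall>y\<in>U. \<rho> (h y) = f (\<pi> y)) \<and> C1_on U h)"

definition torus_C2 ::
  "('a::real_normed_vector \<Rightarrow> 'm) \<Rightarrow> ('b::real_normed_vector \<Rightarrow> 'n) \<Rightarrow> ('m \<Rightarrow> 'n) \<Rightarrow> bool" where
  "torus_C2 \<pi> \<rho> f \<longleftrightarrow>
    (\<forall>x. \<exists>U h. open U \<and> x \<in> U \<and> (\<forall>y\<in>U. \<rho> (h y) = f (\<pi> y)) \<and> C2_on U h)"

definition torus_diffeo ::
  "('a::real_normed_vector \<Rightarrow> 'm) \<Rightarrow> ('m \<Rightarrow> 'm) \<Rightarrow> bool" where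
  "torus_diffeo \<pi> f \<longleftrightarrow> bij f \<and> torus_C1 \<pi> \<pi> f \<and> torus_C1 \<pi> \<pi> (inv f)"

definition direct_sum2 :: "'v::real_vector set \<Rightarrow> 'v set \<Rightarrow> bool" where
  "direct_sum2 S T \<longleftrightarrow> subspace S \<and> subspace T \<and>
    (\<forall>v. \<exists>!w. w \<in> S \<times> T \<and> fst w + snd w = v)"

definition direct_sum3 :: "'v::real_vector set \<Rightarrow> 'v set \<Rightarrow> 'v set \<Rightarrow> bool" where
  "direct_sum3 S T W \<longleftrightarrow> subspace S \<and> subspace T \<and> subspace W \<and>
    (\<forall>v. \<exists>!w. w \<in> S \<times> T \<times> W \<and> fst w + fst (snd w) + snd (snd w) = v)"

definition invariant_field :: "('m \<Rightarrow> 'm) \<Rightarrow> ('m \<Rightarrow> 'v \<Rightarrow> 'v) \<Rightarrow> ('m \<Rightarrow> 'v set) \<Rightarrow> bool" where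
  "invariant_field f Df E \<longleftrightarrow> (\<forall>p. Df p ` E p = E (f p))"

text \<open>Continuity of a field of subspaces: locally it has a continuous frame.\<close>

definition continuous_subbundle ::
  "('m::topological_space \<Rightarrow> 'v::real_normed_vector set) \<Rightarrow> bool" where
  "continuous_subbundle E \<longleftrightarrow>
    (\<forall>q. \<exists>U k (e :: nat \<Rightarrow> 'm \<Rightarrow> 'v). open U \<and> q \<in> U \<and> (\<forall>i<k. continuous_on U (e i)) \<and>
      (\<forall>p\<in>U. inj_on (\<lambda>i. e i p) {..<k} \<and> independent ((\<lambda>i. e i p) ` {..<k}) \<and>
              span ((\<lambda>i. e i p) ` {..<k}) = E p))"

text \<open>No continuity of the splitting is assumed here.\<close>

definition anosov_splitting ::
  "(torus2 \<Rightarrow> torus2) \<Rightarrow> (torus2 \<Rightarrow> (real \<times> real) set) \<Rightarrow> (torus2 \<Rightarrow> (real \<times> real) set) \<Rightarrow>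
   real \<Rightarrow> bool" where
  "anosov_splitting A Es Eu lam \<longleftrightarrow>
    (\<forall>p. direct_sum2 (Es p) (Eu p) \<and> dim (Es p) = 1 \<and> dim (Eu p) = 1) \<and>
    invariant_field A (D2 A) Es \<and> invariant_field A (D2 A) Eu \<and>
    lam < 1 \<and>
    (\<forall>p. \<forall>w\<in>Es p. norm (D2 A p w) \<le> lam * norm w) \<and>
    (\<forall>p. \<forall>v\<in>Eu p. norm (D2 (inv A) p v) \<le> lam * norm v)"

definition attracting_fixpoint :: "('m::topological_space \<Rightarrow> 'm) \<Rightarrow> 'm \<Rightarrow> bool" where
  "attracting_fixpoint f p \<longleftrightarrow> f p = p \<and>
    (\<exists>U. open U \<and> p \<in> U \<and> (\<forall>z\<in>U. (\<lambda>n. (f ^^ n) z) \<longlonglongrightarrow> p))"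

definition repelling_fixpoint :: "('m::topological_space \<Rightarrow> 'm) \<Rightarrow> 'm \<Rightarrow> bool" where
  "repelling_fixpoint f p \<longleftrightarrow> attracting_fixpoint (inv f) p"

definition skew_product ::
  "(torus2 \<Rightarrow> torus2) \<Rightarrow> (circle \<Rightarrow> circle) \<Rightarrow> (circle \<Rightarrow> circle) \<Rightarrow> torus3 \<Rightarrow> torus3" where
  "skew_product A g r = (\<lambda>((x, y), z). (A (x, y), g (z + r x)))"

end

theory Submission imports Defs begin

text \<open>
  In the frame of the base splitting and \<open>\<partial>\<^sub>z\<close>, \<open>DF\<close> is triangular, so one looks for \<open>E\<^sup>u\<close> and \<open>E\<^sup>s\<close> as graphs
  spanned by \<open>(du, \<phi>)\<close> and \<open>(ds, \<psi>)\<close>. With \<open>G = g'(z + r x)\<close>, invariance means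
  \<open>\<alpha>u \<cdot> (\<phi> \<circ> F) = G (\<phi> + r' du\<^sub>1)\<close> and \<open>\<alpha>s \<cdot> (\<psi> \<circ> F) = G (\<psi> + r' ds\<^sub>1)\<close>. The first is a contraction when
  read backwards (\<open>G / \<alpha>u \<le> lam_max \<cdot> lamA < 1\<close>), the second when read forwards
  (\<open>\<alpha>s / G \<le> lamA / lam_min < 1\<close>), so both have bounded continuous solutions. Boundedness of \<open>\<phi>\<close> and \<open>\<psi>\<close>
  makes the growth on the graphs comparable to that on the base.
\<close>

section \<open>Derivatives of maps between tori\<close>

text \<open>\<open>translate\<close> makes the fibres cosets of a subgroup, and
  \<open>discrete\<close> makes that subgroup uniformly discrete. The calculus below uses only these
  axioms, so that circle, tori and vector factors are treated at once.\<close>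

locale torus_cover =
  fixes \<pi> :: "'a::real_normed_vector \<Rightarrow> 'm::topological_space"
  assumes surj: "surj \<pi>"
    and cont: "continuous_on UNIV \<pi>"
    and open_map: "open U \<Longrightarrow> open (\<pi> ` U)"
    and translate: "\<pi> x = \<pi> y \<Longrightarrow> \<pi> (x + a) = \<pi> (y + a)"
    and discrete: "\<exists>\<epsilon>>0. \<forall>x y. \<pi> x = \<pi> y \<longrightarrow> dist x y < \<epsilon> \<longrightarrow> x = y"

text \<open>The trivial cover serves as the factor for tangent vectors: with
  \<open>torus_cover_map_prod\<close> it yields a cover of the tangent bundle, on which derivatives
  are continuous jointly in point and vector.\<close>

lemma torus_cover_id: "torus_cover (\<lambda>x::'a::real_normed_vector. x)"
  by unfold_locales (auto simp: continuous_on_id intro: exI[of _ 1])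

lemma torus_cover_map_prod:
  fixes \<pi> :: "'a::real_normed_vector \<Rightarrow> 'm::topological_space"
    and \<rho> :: "'b::real_normed_vector \<Rightarrow> 'n::topological_space"
  assumes "torus_cover \<pi>" "torus_cover \<rho>"
  shows "torus_cover (map_prod \<pi> \<rho>)"
proof -
  interpret p: torus_cover \<pi> by fact
  interpret r: torus_cover \<rho> by fact
  show ?thesis
  proof
    show "surj (map_prod \<pi> \<rho>)" using p.surj r.surj by (rule map_prod_surj)
    show "continuous_on UNIV (map_prod \<pi> \<rho>)"
      unfolding map_prod_def case_prod_beta
      by (intro continuous_on_Pair continuous_on_compose2[OF p.cont]
          continuous_on_compose2[OF r.cont] continuous_intros) auto
    show "open (map_prod \<pi> \<rho> ` U)" if "open U" for U
    proof (subst open_subopen, rule ballI)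
      fix y assume "y \<in> map_prod \<pi> \<rho> ` U"
      then obtain a b where ab: "(a, b) \<in> U" "y = (\<pi> a, \<rho> b)" by auto
      from open_prod_elim[OF that ab(1)] obtain V W where
        VW: "open V" "open W" "(a, b) \<in> V \<times> W" "V \<times> W \<subseteq> U" by blast
      have "map_prod \<pi> \<rho> ` (V \<times> W) \<subseteq> map_prod \<pi> \<rho> ` U" using VW(4) by (rule image_mono)
      then have "(\<pi> ` V) \<times> (\<rho> ` W) \<subseteq> map_prod \<pi> \<rho> ` U"
        by (subst (asm) map_prod_surj_on[OF refl refl])
      moreover have "open ((\<pi> ` V) \<times> (\<rho> ` W))"
        using VW p.open_map r.open_map by (intro open_Times) auto
      moreover have "y \<in> (\<pi> ` V) \<times> (\<rho> ` W)" using VW ab by auto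
      ultimately show "\<exists>T. open T \<and> y \<in> T \<and> T \<subseteq> map_prod \<pi> \<rho> ` U" by blast
    qed
    show "map_prod \<pi> \<rho> (x + a) = map_prod \<pi> \<rho> (y + a)"
      if "map_prod \<pi> \<rho> x = map_prod \<pi> \<rho> y" for x y a
      using that by (cases x; cases y; cases a) (auto intro: p.translate r.translate)
    obtain \<epsilon> \<delta> where e: "\<epsilon> > 0" "\<And>x y. \<pi> x = \<pi> y \<Longrightarrow> dist x y < \<epsilon> \<Longrightarrow> x = y"
      and d: "\<delta> > 0" "\<And>x y. \<rho> x = \<rho> y \<Longrightarrow> dist x y < \<delta> \<Longrightarrow> x = y"
      using p.discrete r.discrete by metis
    show "\<exists>\<epsilon>>0. \<forall>x y. map_prod \<pi> \<rho> x = map_prod \<pi> \<rho> y \<longrightarrow> dist x y < \<epsilon> \<longrightarrow> x = y"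
    proof (intro exI[of _ "min \<epsilon> \<delta>"] conjI allI impI)
      fix x y assume eq: "map_prod \<pi> \<rho> x = map_prod \<pi> \<rho> y" and "dist x y < min \<epsilon> \<delta>"
      then have "dist (fst x) (fst y) < \<epsilon>" "dist (snd x) (snd y) < \<delta>"
        using dist_fst_le[of x y] dist_snd_le[of x y] by linarith+
      moreover have "\<pi> (fst x) = \<pi> (fst y)" "\<rho> (snd x) = \<rho> (snd y)"
        using eq by (simp_all add: map_prod_def case_prod_beta)
      ultimately show "x = y" using e(2) d(2) by (intro prod_eqI) blast+
    qed (use e d in auto)
  qed
qed

lemma proj1_eq_iff: "proj1 x = proj1 y \<longleftrightarrow> x - y \<in> \<int>"
  by (simp add: circle.abs_eq_iff cong_Z_def)

lemma torus_cover_proj1: "torus_cover proj1"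
proof
  show "surj proj1" by (metis circle.abs_eq_iff Quotient_circle Quotient_abs_rep surjI)
  show "continuous_on UNIV proj1"
    by (auto simp: continuous_on_open_vimage open_circle_def)
  show "open (proj1 ` U)" if "open U" for U
  proof -
    \<comment> \<open>The saturation of an open set is a union of its integer translates, which is
      why \<open>proj1\<close> is open.\<close>
    have "proj1 -` (proj1 ` U) = (\<Union>n\<in>\<int>. (+) n ` U)"
    proof (intro set_eqI iffI)
      fix x assume "x \<in> proj1 -` (proj1 ` U)"
      then obtain u where "u \<in> U" "x - u \<in> \<int>" by (auto simp: proj1_eq_iff)
      then show "x \<in> (\<Union>n\<in>\<int>. (+) n ` U)" by (intro UN_I[of "x - u"]) force+
    next
      fix x assume "x \<in> (\<Union>n\<in>\<int>. (+) n ` U)"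
      then obtain n u where "n \<in> \<int>" "u \<in> U" "x = n + u" by auto
      then show "x \<in> proj1 -` (proj1 ` U)"
        by (auto simp: proj1_eq_iff intro!: image_eqI[of _ _ u])
    qed
    then show ?thesis using that by (auto simp: open_circle_def intro!: open_translation)
  qed
  show "proj1 (x + a) = proj1 (y + a)" if "proj1 x = proj1 y" for x y a
    using that by (simp add: proj1_eq_iff)
  show "\<exists>\<epsilon>>0. \<forall>x y. proj1 x = proj1 y \<longrightarrow> dist x y < \<epsilon> \<longrightarrow> x = y"
  proof (intro exI[of _ 1] conjI allI impI)
    fix x y assume "proj1 x = proj1 y" "dist x y < 1"
    then show "x = y"
      using Ints_nonzero_abs_less1[of "x - y"] by (auto simp: proj1_eq_iff dist_real_def)
  qed simp
qed

lemma torus_cover_proj2: "torus_cover proj2"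
  unfolding proj2_def by (intro torus_cover_map_prod torus_cover_proj1)

lemma torus_cover_proj3: "torus_cover proj3"
  unfolding proj3_def by (intro torus_cover_map_prod torus_cover_proj1 torus_cover_proj2)

context torus_cover
begin

text \<open>Each preimage under \<open>f\<close> is the image under the open surjection
  \<open>\<pi>\<close> of a preimage upstairs, so continuity may be checked on the covering
  space.\<close>

lemma continuous_on_quotient:
  assumes "continuous_on UNIV (\<lambda>x. f (\<pi> x))"
  shows "continuous_on UNIV f"
proof -
  have "open (f -` V)" if "open V" for V
  proof -
    have "open ((\<lambda>x. f (\<pi> x)) -` V)" using assms that by (simp add: continuous_on_open_vimage)
    then have "open (\<pi> ` ((\<lambda>x. f (\<pi> x)) -` V))" by (rule open_map)
    moreover have "\<pi> ` ((\<lambda>x. f (\<pi> x)) -` V) = f -` V" using surj by (auto simp: surj_def) (metis imageI vimageI)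
    ultimately show ?thesis by simp
  qed
  then show ?thesis by (simp add: continuous_on_open_vimage)
qed

lemma ex_preimage: "\<exists>x. \<pi> x = p"
  using surj by (metis surjD)

text \<open>\<open>h y\<close> and \<open>k y + (h x - k x)\<close> lie in one fibre and agree at
  \<open>x\<close>. Near \<open>x\<close> they are closer than the separation constant of the
  fibres, so they coincide.\<close>

lemma eventually_lifts_differ_by_const:
  assumes h: "isCont h x" and k: "isCont k x" and eq: "\<forall>\<^sub>F y in nhds x. \<pi> (h y) = \<pi> (k y)"
  shows "\<forall>\<^sub>F y in nhds x. h y = k y + (h x - k x)"
proof -
  obtain \<epsilon> where e: "\<epsilon> > 0" "\<And>x y. \<pi> x = \<pi> y \<Longrightarrow> dist x y < \<epsilon> \<Longrightarrow> x = y"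
    using discrete by metis
  have "((\<lambda>y. dist (h y) (k y + (h x - k x))) \<longlongrightarrow> dist (h x) (k x + (h x - k x))) (nhds x)"
    using h k by (intro tendsto_intros) (auto simp: continuous_at tendsto_at_iff_tendsto_nhds)
  then have "\<forall>\<^sub>F y in nhds x. dist (h y) (k y + (h x - k x)) < \<epsilon>"
    using e(1) by (intro order_tendstoD(2)) auto
  then show ?thesis using eq
  proof eventually_elim
    case (elim y)
    have "\<pi> (h x) = \<pi> (k x)" using eq by (rule eventually_nhds_x_imp_x)
    \<comment> \<open>This is the fibre relation at \<open>x\<close>, translated by
      \<open>k y - k x\<close>.\<close>
    then have "\<pi> (k y) = \<pi> (k y + (h x - k x))"
      using translate[of "k x" "h x" "k y - k x"] by (simp add: algebra_simps)
    with elim show ?case by (intro e(2)) simp_all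
  qed
qed

end

text \<open>A lift at one preimage of a point becomes a lift at any other after precomposition with
  a translation, which leaves the derivative unchanged. Two derivatives can thus be compared at a
  common preimage.\<close>

lemma has_torus_derivative_at:
  assumes "torus_cover \<pi>" "has_torus_derivative \<pi> \<rho> f L (\<pi> x)"
  shows "\<exists>h. (\<forall>\<^sub>F y in nhds x. \<rho> (h y) = f (\<pi> y)) \<and> (h has_derivative L) (at x)"
proof -
  interpret torus_cover \<pi> by fact
  obtain x' h where x': "\<pi> x' = \<pi> x" and ev: "\<forall>\<^sub>F y in nhds x'. \<rho> (h y) = f (\<pi> y)"
    and h: "(h has_derivative L) (at x')"
    using assms(2) unfolding has_torus_derivative_def by blast
  define t where "t y = y + (x' - x)" for y
  have pt: "\<pi> (t y) = \<pi> y" for y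
    using translate[OF x', of "y - x"] by (simp add: t_def algebra_simps)
  have "isCont t x" unfolding t_def by (intro continuous_intros)
  then have "filterlim t (nhds x') (nhds x)"
    by (simp add: continuous_at tendsto_at_iff_tendsto_nhds) (simp add: t_def)
  with ev have "\<forall>\<^sub>F y in nhds x. \<rho> (h (t y)) = f (\<pi> (t y))" by (rule eventually_compose_filterlim)
  moreover have "(t has_derivative (\<lambda>v. v)) (at x)" "t x = x'"
    unfolding t_def by (auto intro!: derivative_eq_intros)
  then have "((\<lambda>y. h (t y)) has_derivative (\<lambda>v. L v)) (at x)"
    using has_derivative_compose[of t "\<lambda>v. v" x UNIV h L] h by simp
  ultimately show ?thesis using pt by auto
qed

text \<open>Lifts at a common preimage differ by a constant near it and hence have the same
  derivative. This makes the choice in \<open>torus_derivative\<close> determinate.\<close>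

lemma has_torus_derivative_unique:
  assumes "torus_cover \<pi>" "torus_cover \<rho>"
    "has_torus_derivative \<pi> \<rho> f L p" "has_torus_derivative \<pi> \<rho> f M p"
  shows "L = M"
proof -
  interpret p: torus_cover \<pi> by fact
  interpret r: torus_cover \<rho> by fact
  obtain x where x: "\<pi> x = p" using p.ex_preimage by blast
  obtain h where h: "\<forall>\<^sub>F y in nhds x. \<rho> (h y) = f (\<pi> y)" "(h has_derivative L) (at x)"
    using has_torus_derivative_at assms x by blast
  obtain k where k: "\<forall>\<^sub>F y in nhds x. \<rho> (k y) = f (\<pi> y)" "(k has_derivative M) (at x)"
    using has_torus_derivative_at assms x by blast
  have "\<forall>\<^sub>F y in nhds x. \<rho> (h y) = \<rho> (k y)" using h(1) k(1) by eventually_elim simp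
  then have "\<forall>\<^sub>F y in nhds x. h y = k y + (h x - k x)"
    using h(2) k(2) by (intro r.eventually_lifts_differ_by_const) (auto dest: has_derivative_continuous)
  then have "\<forall>\<^sub>F y in at x. k y + (h x - k x) = h y"
    by (auto simp: eventually_at_filter elim: eventually_mono)
  moreover have "((\<lambda>y. k y + (h x - k x)) has_derivative M) (at x)"
    using k(2) by (auto intro!: derivative_eq_intros)
  ultimately have "(h has_derivative M) (at x)"
    by (elim has_derivative_transform_eventually[rotated]) auto
  with h(2) show ?thesis by (rule has_derivative_unique)
qed

lemma torus_derivative_eq:
  assumes "torus_cover \<pi>" "torus_cover \<rho>" "has_torus_derivative \<pi> \<rho> f L p"
  shows "torus_derivative \<pi> \<rho> f p = L"
  unfolding torus_derivative_def
  by (rule some_equality) (use assms has_torus_derivative_unique in blast)+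

lemma has_torus_derivative_compose:
  assumes "torus_cover \<rho>"
    and f: "has_torus_derivative \<pi> \<rho> f L p" and g: "has_torus_derivative \<rho> \<sigma> g M (f p)"
  shows "has_torus_derivative \<pi> \<sigma> (g \<circ> f) (M \<circ> L) p"
proof -
  obtain x h where x: "\<pi> x = p" and h: "\<forall>\<^sub>F y in nhds x. \<rho> (h y) = f (\<pi> y)"
    "(h has_derivative L) (at x)"
    using f unfolding has_torus_derivative_def by blast
  have "\<rho> (h x) = f p" using eventually_nhds_x_imp_x[OF h(1)] x by simp
  \<comment> \<open>The lift of \<open>g\<close> has to be based at \<open>h x\<close>, the point
    over \<open>f p\<close> that the lift of \<open>f\<close> reaches.\<close>
  with g has_torus_derivative_at[OF assms(1)] obtain k where
    k: "\<forall>\<^sub>F y in nhds (h x). \<sigma> (k y) = g (\<rho> y)" "(k has_derivative M) (at (h x))"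
    by metis
  have "filterlim h (nhds (h x)) (nhds x)"
    using has_derivative_continuous[OF h(2)] by (simp add: continuous_at tendsto_at_iff_tendsto_nhds)
  with k(1) have "\<forall>\<^sub>F y in nhds x. \<sigma> (k (h y)) = g (\<rho> (h y))" by (rule eventually_compose_filterlim)
  with h(1) have "\<forall>\<^sub>F y in nhds x. \<sigma> ((k \<circ> h) y) = (g \<circ> f) (\<pi> y)" by eventually_elim simp
  moreover have "(k \<circ> h has_derivative M \<circ> L) (at x)" using h(2) k(2) by (rule diff_chain_at)
  ultimately show ?thesis unfolding has_torus_derivative_def using x by blast
qed

lemma has_torus_derivative_id: "torus_cover \<pi> \<Longrightarrow> has_torus_derivative \<pi> \<pi> (\<lambda>p. p) (\<lambda>v. v) p"
  unfolding has_torus_derivative_def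
  using torus_cover.ex_preimage[of \<pi> p] by (auto intro!: exI[of _ "\<lambda>y. y"])

lemma torus_C1_has_torus_derivative:
  assumes "torus_cover \<pi>" "torus_cover \<rho>" "torus_C1 \<pi> \<rho> f"
  shows "has_torus_derivative \<pi> \<rho> f (torus_derivative \<pi> \<rho> f p) p"
proof -
  obtain x where x: "\<pi> x = p" using torus_cover.ex_preimage[OF assms(1)] by blast
  obtain U h where U: "open U" "x \<in> U" "\<forall>y\<in>U. \<rho> (h y) = f (\<pi> y)" "C1_on U h"
    using assms(3) unfolding torus_C1_def by blast
  then obtain L where "(h has_derivative L) (at x)" unfolding C1_on_def by blast
  moreover have "\<forall>\<^sub>F y in nhds x. \<rho> (h y) = f (\<pi> y)" using U by (auto simp: eventually_nhds)
  ultimately have "has_torus_derivative \<pi> \<rho> f L p" unfolding has_torus_derivative_def using x by blast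
  with torus_derivative_eq[OF assms(1,2)] show ?thesis by metis
qed

lemma linear_torus_derivative:
  assumes "torus_cover \<pi>" "torus_cover \<rho>" "torus_C1 \<pi> \<rho> f"
  shows "linear (torus_derivative \<pi> \<rho> f p)"
  using torus_C1_has_torus_derivative[OF assms, of p]
  unfolding has_torus_derivative_def by (auto dest: has_derivative_linear)

lemma continuous_on_UNIV_locally:
  assumes "\<And>x. \<exists>U. open U \<and> x \<in> U \<and> continuous_on U f"
  shows "continuous_on UNIV f"
proof -
  have "continuous_on (\<Union>{U. open U \<and> continuous_on U f}) f"
    by (rule continuous_on_open_Union) auto
  moreover have "\<Union>{U. open U \<and> continuous_on U f} = UNIV" using assms by blast
  ultimately show ?thesis by simp
qed

lemma torus_C1_continuous:
  assumes "torus_cover \<pi>" "torus_cover \<rho>" "torus_C1 \<pi> \<rho> f"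
  shows "continuous_on UNIV f"
proof (rule torus_cover.continuous_on_quotient[OF assms(1)], rule continuous_on_UNIV_locally)
  fix x
  obtain U h where U: "open U" "x \<in> U" "\<forall>y\<in>U. \<rho> (h y) = f (\<pi> y)" "C1_on U h"
    using assms(3) unfolding torus_C1_def by blast
  have "continuous_on U h" using U(4) unfolding C1_on_def
    by (meson continuous_at_imp_continuous_on has_derivative_continuous)
  then have "continuous_on U (\<lambda>y. \<rho> (h y))"
    by (rule continuous_on_compose2[OF torus_cover.cont[OF assms(2)]]) auto
  then have "continuous_on U (\<lambda>y. f (\<pi> y))" by (rule continuous_on_eq) (use U in auto)
  with U show "\<exists>U. open U \<and> x \<in> U \<and> continuous_on U (\<lambda>y. f (\<pi> y))" by blast
qed

text \<open>In a chart the derivative is evaluation of a continuous family of bounded linear maps,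
  hence jointly continuous, and \<open>\<pi>\<close> times the identity carries this down to the
  torus. The joint form is what allows derivatives to be iterated on vectors.\<close>

lemma continuous_on_torus_derivative:
  fixes \<pi> :: "'a::real_normed_vector \<Rightarrow> 'm::topological_space"
    and \<rho> :: "'b::real_normed_vector \<Rightarrow> 'n::topological_space"
  assumes "torus_cover \<pi>" "torus_cover \<rho>" "torus_C1 \<pi> \<rho> f"
  shows "continuous_on UNIV (\<lambda>q. torus_derivative \<pi> \<rho> f (fst q) (snd q))"
proof (rule torus_cover.continuous_on_quotient[OF torus_cover_map_prod[OF assms(1) torus_cover_id]],
    rule continuous_on_UNIV_locally)
  fix q :: "'a \<times> 'a"
  obtain U h where U: "open U" "fst q \<in> U" "\<forall>y\<in>U. \<rho> (h y) = f (\<pi> y)" "C1_on U h"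
    using assms(3) unfolding torus_C1_def by blast
  then obtain h' where h': "\<And>x. x \<in> U \<Longrightarrow> (h has_derivative blinfun_apply (h' x)) (at x)"
    "continuous_on U h'" unfolding C1_on_def by blast
  have "torus_derivative \<pi> \<rho> f (\<pi> x) = blinfun_apply (h' x)" if "x \<in> U" for x
  proof (rule torus_derivative_eq[OF assms(1,2)], unfold has_torus_derivative_def, intro exI conjI)
    show "\<forall>\<^sub>F y in nhds x. \<rho> (h y) = f (\<pi> y)" using U that by (auto simp: eventually_nhds)
  qed (use h' that in auto)
  moreover have "continuous_on (U \<times> UNIV) (\<lambda>z. blinfun_apply (h' (fst z)) (snd z))"
    by (intro continuous_intros continuous_on_compose2[OF h'(2)]) auto
  ultimately have "continuous_on (U \<times> UNIV) (\<lambda>z. torus_derivative \<pi> \<rho> f (fst (map_prod \<pi> (\<lambda>x. x) z))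
      (snd (map_prod \<pi> (\<lambda>x. x) z)))"
    by (elim continuous_on_eq) auto
  with U show "\<exists>U. open U \<and> q \<in> U \<and> continuous_on U (\<lambda>z. torus_derivative \<pi> \<rho> f
      (fst (map_prod \<pi> (\<lambda>x. x) z)) (snd (map_prod \<pi> (\<lambda>x. x) z)))"
    by (intro exI[of _ "U \<times> UNIV"]) (auto simp: open_Times mem_Times_iff)
qed

section \<open>Twisted cohomological equations and contracted directions\<close>

text \<open>Repeated substitution of the equation into itself gives a series dominated by a
  geometric one, whose uniform limit is continuous. Both invariant graphs come from here, with
  different \<open>S\<close>.\<close>

lemma ex_bounded_continuous_twisted_equation:
  fixes S :: "'m::topological_space \<Rightarrow> 'm" and a b :: "'m \<Rightarrow> real"
  assumes "continuous_on UNIV S" "continuous_on UNIV a" "continuous_on UNIV b"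
    and a: "\<And>q. \<bar>a q\<bar> \<le> k" "k < 1" and b: "\<And>q. \<bar>b q\<bar> \<le> B"
  obtains \<phi> M where "continuous_on UNIV \<phi>" "\<And>q. \<bar>\<phi> q\<bar> \<le> M" "\<And>q. \<phi> q = a q * \<phi> (S q) + b q"
proof -
  \<comment> \<open>The term \<open>b\<close> produced by the \<open>n\<close>-th substitution,
    times the factors met along the orbit before it.\<close>
  define c where "c n q = (\<Prod>i<n. a ((S ^^ i) q)) * b ((S ^^ n) q)" for n q
  have k: "0 \<le> k" using a(1) abs_ge_zero order_trans by blast
  have contS: "continuous_on UNIV (S ^^ n)" for n
    by (induction n) (auto intro: continuous_on_id continuous_on_compose2[OF assms(1)] simp: o_def id_def)
  have c: "continuous_on UNIV (c n)" for n
    unfolding c_def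
    by (intro continuous_intros continuous_on_compose2[OF assms(2)] continuous_on_compose2[OF assms(3)] contS) auto
  have bound: "norm (c n q) \<le> k ^ n * B" for n q
  proof -
    have "\<bar>\<Prod>i<n. a ((S ^^ i) q)\<bar> \<le> (\<Prod>i<n. k)"
      unfolding abs_prod using a by (intro prod_mono) auto
    then show ?thesis unfolding c_def using b k by (auto simp: abs_mult intro!: mult_mono)
  qed
  have geom: "summable (\<lambda>n. k ^ n * B)" using k a(2) by (intro summable_mult2 summable_geometric) auto
  have sums: "summable (\<lambda>n. c n q)" for q
    using summable_comparison_test'[OF geom, of 0 "\<lambda>n. c n q"] bound by simp
  define \<phi> where "\<phi> q = (\<Sum>n. c n q)" for q
  have "uniform_limit UNIV (\<lambda>n q. \<Sum>i<n. c i q) \<phi> sequentially"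
    unfolding \<phi>_def using bound geom by (intro Weierstrass_m_test) auto
  then have "continuous_on UNIV \<phi>"
    by (rule uniform_limit_theorem[rotated]) (auto intro!: always_eventually continuous_intros c)
  moreover have "\<bar>\<phi> q\<bar> \<le> (\<Sum>n. k ^ n * B)" for q
    unfolding \<phi>_def real_norm_def[symmetric] by (rule norm_suminf_le) (use bound geom in auto)
  moreover have "\<phi> q = a q * \<phi> (S q) + b q" for q
  proof -
    \<comment> \<open>Shifting the orbit by one turns the tail of the series at \<open>q\<close>
      into \<open>a q\<close> times the series at \<open>S q\<close>; the term of index
      \<open>0\<close> is \<open>b q\<close>.\<close>
    have "c (Suc n) q = a q * c n (S q)" for n
      unfolding c_def prod.lessThan_Suc_shift by (simp add: funpow_swap1)
    then have "(\<Sum>n. a q * c n (S q)) = \<phi> q - c 0 q"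
      using suminf_split_head[OF sums[of q]] by (simp add: \<phi>_def)
    then show ?thesis using suminf_mult[OF sums[of "S q"], of "a q"] by (simp add: \<phi>_def c_def)
  qed
  ultimately show ?thesis using that by blast
qed

text \<open>The contracted direction of a hyperbolic cocycle consists of the vectors \<open>w\<close> whose iterates are
  bounded by \<open>lam ^ n * norm w\<close> for all \<open>n\<close>. This is a closed condition, which gives continuity.\<close>

lemma continuous_contracted_direction:
  fixes \<pi> :: "'a::euclidean_space \<Rightarrow> 'm::topological_space"
    and D :: "'m \<Rightarrow> 'v::euclidean_space \<Rightarrow> 'v"
  assumes cover: "torus_cover \<pi>"
    and f: "continuous_on UNIV f"
    and D: "continuous_on UNIV (\<lambda>q. D (fst q) (snd q))" "\<And>p. linear (D p)"
    and lam: "0 < lam" "lam < 1"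
    and s: "\<And>p. D p (s p) = a p *\<^sub>R s (f p)" "\<And>p. \<bar>a p\<bar> \<le> lam" "\<And>p. norm (s p) = 1"
    and u: "\<And>p. D p (u p) = b p *\<^sub>R u (f p)" "\<And>p. inverse lam \<le> \<bar>b p\<bar>" "\<And>p. norm (u p) = 1"
    and basis: "\<And>p w. \<exists>\<xi> \<eta>. w = \<xi> *\<^sub>R s p + \<eta> *\<^sub>R u p"
    and e: "\<And>p. \<beta> \<le> s p \<bullet> e" "\<beta> > 0"
  shows "continuous_on UNIV s"
proof -
  \<comment> \<open>\<open>G\<close> is the derivative cocycle on pairs of base point and vector:
    its iterates carry a vector along the orbit and are continuous in both arguments.\<close>
  define G where "G q = (f (fst q), D (fst q) (snd q))" for q
  have contG: "continuous_on UNIV G"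
    unfolding G_def by (intro continuous_intros D continuous_on_compose2[OF f]) auto
  have contGn: "continuous_on UNIV (G ^^ n)" for n
    by (induction n) (auto intro: continuous_on_id continuous_on_compose2[OF contG] simp: o_def id_def)
  \<comment> \<open>In the frame \<open>s\<close>, \<open>u\<close> the cocycle is diagonal;
    \<open>A\<close> and \<open>B\<close> are the multipliers accumulated over \<open>n\<close>
    steps.\<close>
  have iter: "\<exists>A B. \<bar>A\<bar> \<le> lam ^ n \<and> inverse lam ^ n \<le> \<bar>B\<bar> \<and>
      (\<forall>\<xi> \<eta>. (G ^^ n) (p, \<xi> *\<^sub>R s p + \<eta> *\<^sub>R u p) =
        ((f ^^ n) p, (A * \<xi>) *\<^sub>R s ((f ^^ n) p) + (B * \<eta>) *\<^sub>R u ((f ^^ n) p)))" for n p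
  proof (induction n)
    case (Suc n)
    then obtain A B where AB: "\<bar>A\<bar> \<le> lam ^ n" "inverse lam ^ n \<le> \<bar>B\<bar>"
      "\<And>\<xi> \<eta>. (G ^^ n) (p, \<xi> *\<^sub>R s p + \<eta> *\<^sub>R u p) =
        ((f ^^ n) p, (A * \<xi>) *\<^sub>R s ((f ^^ n) p) + (B * \<eta>) *\<^sub>R u ((f ^^ n) p))" by blast
    let ?p = "(f ^^ n) p"
    have "\<bar>a ?p * A\<bar> \<le> lam ^ Suc n" unfolding abs_mult power_Suc
      using s(2)[of ?p] AB(1) lam by (intro mult_mono) auto
    moreover have "inverse lam ^ Suc n \<le> \<bar>b ?p * B\<bar>" unfolding abs_mult power_Suc
      using u(2)[of ?p] AB(2) lam by (intro mult_mono) auto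
    moreover have "(G ^^ Suc n) (p, \<xi> *\<^sub>R s p + \<eta> *\<^sub>R u p) =
        ((f ^^ Suc n) p, (a ?p * A * \<xi>) *\<^sub>R s ((f ^^ Suc n) p) + (b ?p * B * \<eta>) *\<^sub>R u ((f ^^ Suc n) p))"
      for \<xi> \<eta>
      by (simp only: funpow.simps o_apply AB(3)) (simp add: G_def linear_add[OF D(2)] linear_cmul[OF D(2)] s(1) u(1) ac_simps)
    ultimately show ?case by blast
  qed (auto intro!: exI[of _ 1])
  \<comment> \<open>The decay bound kills the \<open>u\<close> component, the norm then leaves
    \<open>s p\<close> and \<open>- s p\<close>, and the inner product with \<open>e\<close>
    excludes the latter. Bounding it by \<open>\<beta>\<close> non-strictly keeps every condition
    closed.\<close>
  have slow_iff: "w = s p \<longleftrightarrow> norm w = 1 \<and> \<beta> \<le> w \<bullet> e \<and> (\<forall>n. norm (snd ((G ^^ n) (p, w))) \<le> lam ^ n)"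
    for p w
  proof
    assume w: "w = s p"
    have "norm (snd ((G ^^ n) (p, w))) \<le> lam ^ n" for n
    proof -
      obtain A B where AB: "\<bar>A\<bar> \<le> lam ^ n"
        "\<And>\<xi> \<eta>. (G ^^ n) (p, \<xi> *\<^sub>R s p + \<eta> *\<^sub>R u p) =
        ((f ^^ n) p, (A * \<xi>) *\<^sub>R s ((f ^^ n) p) + (B * \<eta>) *\<^sub>R u ((f ^^ n) p))"
        using iter[of n p] by blast
      show ?thesis using AB(2)[of 1 0] AB(1) by (simp add: w s(3))
    qed
    then show "norm w = 1 \<and> \<beta> \<le> w \<bullet> e \<and> (\<forall>n. norm (snd ((G ^^ n) (p, w))) \<le> lam ^ n)"
      using w s(3) e by simp
  next
    assume w: "norm w = 1 \<and> \<beta> \<le> w \<bullet> e \<and> (\<forall>n. norm (snd ((G ^^ n) (p, w))) \<le> lam ^ n)"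
    obtain \<xi> \<eta> where \<xi>\<eta>: "w = \<xi> *\<^sub>R s p + \<eta> *\<^sub>R u p" using basis by blast
    have "\<bar>\<eta>\<bar> \<le> (1 + \<bar>\<xi>\<bar>) * lam ^ n" for n
    proof -
      obtain A B where AB: "\<bar>A\<bar> \<le> lam ^ n" "inverse lam ^ n \<le> \<bar>B\<bar>"
        "(G ^^ n) (p, \<xi> *\<^sub>R s p + \<eta> *\<^sub>R u p) =
        ((f ^^ n) p, (A * \<xi>) *\<^sub>R s ((f ^^ n) p) + (B * \<eta>) *\<^sub>R u ((f ^^ n) p))"
        using iter[of n p] by blast
      have "norm (snd ((G ^^ n) (p, w))) \<le> lam ^ n" using w by blast
      then have "norm ((A * \<xi>) *\<^sub>R s ((f ^^ n) p) + (B * \<eta>) *\<^sub>R u ((f ^^ n) p)) \<le> lam ^ n"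
        by (simp add: \<xi>\<eta> AB(3))
      moreover have "norm ((B * \<eta>) *\<^sub>R u ((f ^^ n) p)) - norm ((A * \<xi>) *\<^sub>R s ((f ^^ n) p))
          \<le> norm ((A * \<xi>) *\<^sub>R s ((f ^^ n) p) + (B * \<eta>) *\<^sub>R u ((f ^^ n) p))"
        by (metis add.commute norm_diff_ineq)
      ultimately have "\<bar>B\<bar> * \<bar>\<eta>\<bar> \<le> lam ^ n + \<bar>A\<bar> * \<bar>\<xi>\<bar>" by (simp add: s(3) u(3) abs_mult)
      also have "\<dots> \<le> lam ^ n + lam ^ n * \<bar>\<xi>\<bar>" using AB(1) by (intro add_mono mult_right_mono) auto
      finally have 1: "\<bar>B\<bar> * \<bar>\<eta>\<bar> \<le> (1 + \<bar>\<xi>\<bar>) * lam ^ n" by (simp add: algebra_simps)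
      \<comment> \<open>With \<open>1 <= |B|\<close> the coefficient \<open>\<eta>\<close> is
        bounded by a multiple of \<open>lam ^ n\<close> for every \<open>n\<close>, so the limit
        forces it to vanish.\<close>
      have "1 \<le> inverse lam ^ n" using lam by (intro one_le_power) (simp add: one_le_inverse)
      then have "1 \<le> \<bar>B\<bar>" using AB(2) by linarith
      then have "\<bar>\<eta>\<bar> \<le> \<bar>B\<bar> * \<bar>\<eta>\<bar>" by (simp add: mult_le_cancel_right1)
      with 1 show ?thesis by linarith
    qed
    moreover have "(\<lambda>n. (1 + \<bar>\<xi>\<bar>) * lam ^ n) \<longlonglongrightarrow> (1 + \<bar>\<xi>\<bar>) * 0"
      using lam by (intro tendsto_intros LIMSEQ_realpow_zero) auto
    ultimately have "\<bar>\<eta>\<bar> \<le> (1 + \<bar>\<xi>\<bar>) * 0" by (meson LIMSEQ_le_const)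
    then have \<xi>: "w = \<xi> *\<^sub>R s p" using \<xi>\<eta> by simp
    moreover have "\<bar>\<xi>\<bar> = 1" using w by (simp add: \<xi> s(3))
    moreover have "0 < \<xi>" using w e(1)[of p] e(2) by (simp add: \<xi>) (smt (verit) zero_less_mult_iff)
    ultimately show "w = s p" by simp
  qed
  have "continuous_on UNIV (\<lambda>x. s (\<pi> x))"
  \<comment> \<open>The values lie in the compact unit sphere, so a closed graph gives
    continuity.\<close>
  proof (rule continuous_from_closed_graph[of "sphere 0 1"])
    have \<pi>: "continuous_on UNIV \<pi>" using cover by (rule torus_cover.cont)
    have "(\<lambda>x. (x, s (\<pi> x))) ` UNIV = {z. norm (snd z) = 1} \<inter> {z. \<beta> \<le> snd z \<bullet> e} \<inter>
        (\<Inter>n. {z. norm (snd ((G ^^ n) (\<pi> (fst z), snd z))) \<le> lam ^ n})"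
    proof (rule set_eqI)
      fix z :: "'a \<times> 'v"
      have "z \<in> (\<lambda>x. (x, s (\<pi> x))) ` UNIV \<longleftrightarrow> snd z = s (\<pi> (fst z))" by (cases z) auto
      then show "z \<in> (\<lambda>x. (x, s (\<pi> x))) ` UNIV \<longleftrightarrow> z \<in> {z. norm (snd z) = 1} \<inter> {z. \<beta> \<le> snd z \<bullet> e} \<inter>
        (\<Inter>n. {z. norm (snd ((G ^^ n) (\<pi> (fst z), snd z))) \<le> lam ^ n})"
        unfolding slow_iff by simp
    qed
    moreover have "closed ({z. norm (snd z) = 1} \<inter> {z. \<beta> \<le> snd z \<bullet> e} \<inter>
        (\<Inter>n. {z :: 'a \<times> 'v. norm (snd ((G ^^ n) (\<pi> (fst z), snd z))) \<le> lam ^ n}))"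
      by (intro closed_Int closed_INT ballI closed_Collect_eq closed_Collect_le continuous_intros
          continuous_on_compose2[OF contGn] continuous_on_compose2[OF \<pi>]) auto
    ultimately show "closed ((\<lambda>x. (x, s (\<pi> x))) ` UNIV)" by simp
  qed (auto simp: s(3))
  then show ?thesis by (rule torus_cover.continuous_on_quotient[OF cover])
qed

section \<open>The skew product\<close>

text \<open>Subtraction on pairs lifts to ordinary subtraction on the covering plane, where its
  continuity is plain; the general case is a composition.\<close>

lemma continuous_on_circle_minus:
  assumes "continuous_on UNIV f" "continuous_on UNIV g"
  shows "continuous_on UNIV (\<lambda>x. f x - g x :: circle)"
proof -
  have "continuous_on UNIV (\<lambda>q :: circle \<times> circle. fst q - snd q)"
  proof (rule torus_cover.continuous_on_quotient[OF torus_cover_map_prod[OF torus_cover_proj1 torus_cover_proj1]])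
    show "continuous_on UNIV (\<lambda>x. fst (map_prod proj1 proj1 x) - snd (map_prod proj1 proj1 x))"
      by (simp add: minus_circle.abs_eq map_prod_def case_prod_beta)
         (intro continuous_on_compose2[OF torus_cover.cont[OF torus_cover_proj1]] continuous_intros, auto)
  qed
  then show ?thesis
    using continuous_on_compose2[of UNIV "\<lambda>q. fst q - snd q" UNIV "\<lambda>x. (f x, g x)"] assms
    by (auto intro: continuous_on_Pair)
qed

lemma continuous_on_circle_plus:
  assumes "continuous_on UNIV f" "continuous_on UNIV g"
  shows "continuous_on UNIV (\<lambda>x. f x + g x :: circle)"
  using continuous_on_circle_minus[OF assms(1) continuous_on_circle_minus[OF continuous_on_const[of _ 0] assms(2)]]
  by simp

lemma continuous_on_circle_deriv:
  assumes "torus_C1 proj1 proj1 f"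
  shows "continuous_on UNIV (circle_deriv f)"
  unfolding circle_deriv_def
  using continuous_on_compose2[OF continuous_on_torus_derivative[OF torus_cover_proj1 torus_cover_proj1 assms],
      of UNIV "\<lambda>p. (p, 1)"]
  by (simp add: continuous_on_Pair continuous_on_id)

lemma torus_derivative_circle:
  assumes "torus_C1 proj1 proj1 f"
  shows "torus_derivative proj1 proj1 f p = (\<lambda>t. circle_deriv f p * t)"
proof
  fix t
  show "torus_derivative proj1 proj1 f p t = circle_deriv f p * t"
    using linear_cmul[OF linear_torus_derivative[OF torus_cover_proj1 torus_cover_proj1 assms], of p t 1]
    by (simp add: circle_deriv_def mult.commute)
qed

lemma torus_C1_local_lift:
  assumes "torus_cover \<pi>" "torus_cover \<rho>" "torus_C1 \<pi> \<rho> f"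
  obtains h where "\<forall>\<^sub>F y in nhds x. \<rho> (h y) = f (\<pi> y)"
    "(h has_derivative torus_derivative \<pi> \<rho> f (\<pi> x)) (at x)"
  using has_torus_derivative_at[OF assms(1) torus_C1_has_torus_derivative[OF assms]] by blast

text \<open>A lift is assembled from local lifts of \<open>A\<close>, \<open>g\<close> and
  \<open>r\<close>, and the chain rule yields the triangular form: base vectors enter the fibre
  component through the derivative of \<open>r\<close>.\<close>

lemma has_torus_derivative_skew_product:
  assumes A: "torus_C1 proj2 proj2 A" and g: "torus_C1 proj1 proj1 g" and r: "torus_C1 proj1 proj1 r"
  shows "has_torus_derivative proj3 proj3 (skew_product A g r)
    (\<lambda>v. (D2 A (fst q) (fst v),
       circle_deriv g (snd q + r (fst (fst q))) * (snd v + circle_deriv r (fst (fst q)) * fst (fst v)))) q"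
proof -
  obtain x where x: "proj3 x = q" using torus_cover.ex_preimage[OF torus_cover_proj3] by blast
  then have q: "fst q = proj2 (fst x)" "fst (fst q) = proj1 (fst (fst x))" "snd q = proj1 (snd x)"
    by (auto simp: proj3_def proj2_def)
  obtain hA where hA: "\<forall>\<^sub>F y in nhds (fst x). proj2 (hA y) = A (proj2 y)"
    "(hA has_derivative D2 A (fst q)) (at (fst x))"
    unfolding q(1) by (rule torus_C1_local_lift[OF torus_cover_proj2 torus_cover_proj2 A])
  obtain hr where hr: "\<forall>\<^sub>F y in nhds (fst (fst x)). proj1 (hr y) = r (proj1 y)"
    "(hr has_derivative (\<lambda>t. circle_deriv r (fst (fst q)) * t)) (at (fst (fst x)))"
    unfolding q(2) torus_derivative_circle[OF r, symmetric]
    by (rule torus_C1_local_lift[OF torus_cover_proj1 torus_cover_proj1 r])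
  \<comment> \<open>This fixes where the lift of \<open>g\<close> is to be based: at the point to
    which the lift of the rotated fibre coordinate sends \<open>x\<close>.\<close>
  have qr: "snd q + r (fst (fst q)) = proj1 (snd x + hr (fst (fst x)))"
    using eventually_nhds_x_imp_x[OF hr(1)] by (simp add: q(2,3) plus_circle.abs_eq[symmetric])
  obtain hg where hg: "\<forall>\<^sub>F y in nhds (snd x + hr (fst (fst x))). proj1 (hg y) = g (proj1 y)"
    "(hg has_derivative (\<lambda>t. circle_deriv g (snd q + r (fst (fst q))) * t)) (at (snd x + hr (fst (fst x))))"
    unfolding qr torus_derivative_circle[OF g, symmetric]
    by (rule torus_C1_local_lift[OF torus_cover_proj1 torus_cover_proj1 g])
  define k where "k y = snd y + hr (fst (fst y))" for y :: "(real \<times> real) \<times> real"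
  have k: "(k has_derivative (\<lambda>v. snd v + circle_deriv r (fst (fst q)) * fst (fst v))) (at x)"
    unfolding k_def
    by (intro has_derivative_add has_derivative_snd has_derivative_ident
        has_derivative_compose[OF has_derivative_fst[OF has_derivative_fst[OF has_derivative_ident]] hr(2)])
  have "((\<lambda>y. hA (fst y)) has_derivative (\<lambda>v. D2 A (fst q) (fst v))) (at x)"
    by (rule has_derivative_compose[OF has_derivative_fst[OF has_derivative_ident] hA(2)])
  moreover have "((\<lambda>y. hg (k y)) has_derivative (\<lambda>v.
       circle_deriv g (snd q + r (fst (fst q))) * (snd v + circle_deriv r (fst (fst q)) * fst (fst v)))) (at x)"
    by (rule has_derivative_compose[OF k hg(2)[folded k_def]])
  ultimately have "((\<lambda>y. (hA (fst y), hg (k y))) has_derivative (\<lambda>v. (D2 A (fst q) (fst v),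
       circle_deriv g (snd q + r (fst (fst q))) * (snd v + circle_deriv r (fst (fst q)) * fst (fst v))))) (at x)"
    by (rule has_derivative_Pair)
  moreover have "\<forall>\<^sub>F y in nhds x. proj3 (hA (fst y), hg (k y)) = skew_product A g r (proj3 y)"
  proof -
    have "filterlim fst (nhds (fst x)) (nhds x)" "filterlim (\<lambda>y. fst (fst y)) (nhds (fst (fst x))) (nhds x)"
      by (intro tendsto_intros filterlim_ident)+
    note eventually_compose_filterlim[OF hA(1) this(1)] eventually_compose_filterlim[OF hr(1) this(2)]
    moreover have "filterlim k (nhds (k x)) (nhds x)"
      using has_derivative_continuous[OF k] by (simp add: continuous_at tendsto_at_iff_tendsto_nhds)
    then have "\<forall>\<^sub>F y in nhds x. proj1 (hg (k y)) = g (proj1 (k y))"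
      by (rule eventually_compose_filterlim[OF hg(1), folded k_def])
    ultimately show ?thesis
      by eventually_elim
        (auto simp: proj3_def proj2_def skew_product_def k_def plus_circle.abs_eq[symmetric] split: prod.splits)
  qed
  ultimately show ?thesis
    unfolding has_torus_derivative_def using x
    by (intro exI[of _ x] exI[of _ "\<lambda>y. (hA (fst y), hg (k y))"] conjI)
qed

text \<open>By the chain rule the multipliers of an equivariant vector field multiply along the
  orbit. Growth estimates for the derivative of \<open>f ^^ n\<close> thereby become estimates of
  products.\<close>

lemma torus_derivative_funpow_eigenvector:
  assumes "torus_cover \<pi>" and f: "\<And>p. has_torus_derivative \<pi> \<pi> f (D p) p"
    and e: "\<And>p. linear (D p)" "\<And>p. D p (e p) = a p *\<^sub>R e (f p)"
  shows "torus_derivative \<pi> \<pi> (f ^^ n) p (t *\<^sub>R e p) = (t * (\<Prod>i<n. a ((f ^^ i) p))) *\<^sub>R e ((f ^^ n) p)"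
proof -
  \<comment> \<open>The induction carries some derivative; uniqueness identifies it with
    \<open>torus_derivative\<close> at the end.\<close>
  have "\<exists>L. has_torus_derivative \<pi> \<pi> (f ^^ n) L p \<and>
      (\<forall>t. L (t *\<^sub>R e p) = (t * (\<Prod>i<n. a ((f ^^ i) p))) *\<^sub>R e ((f ^^ n) p))"
  proof (induction n)
    case 0
    then show ?case using has_torus_derivative_id[OF assms(1)] by (intro exI[of _ "\<lambda>v. v"]) (simp add: id_def)
  next
    case (Suc n)
    then obtain L where L: "has_torus_derivative \<pi> \<pi> (f ^^ n) L p"
      "\<And>t. L (t *\<^sub>R e p) = (t * (\<Prod>i<n. a ((f ^^ i) p))) *\<^sub>R e ((f ^^ n) p)" by blast
    have "has_torus_derivative \<pi> \<pi> (f ^^ Suc n) (D ((f ^^ n) p) \<circ> L) p"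
      using has_torus_derivative_compose[OF assms(1) L(1) f] by simp
    then show ?case
      by (intro exI[of _ "D ((f ^^ n) p) \<circ> L"]) (simp add: L(2) linear_cmul[OF e(1)] e(2) mult.assoc o_def)
  qed
  then show ?thesis using torus_derivative_eq[OF assms(1) assms(1)] by blast
qed

lemma continuous_subbundle_span_singleton:
  assumes "continuous_on UNIV e" "\<And>p. e p \<noteq> 0"
  shows "continuous_subbundle (\<lambda>p. span {e p})"
  unfolding continuous_subbundle_def
proof
  fix q
  show "\<exists>U k (b :: nat \<Rightarrow> 'a \<Rightarrow> 'b). open U \<and> q \<in> U \<and> (\<forall>i<k. continuous_on U (b i)) \<and>
      (\<forall>p\<in>U. inj_on (\<lambda>i. b i p) {..<k} \<and> independent ((\<lambda>i. b i p) ` {..<k}) \<and>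
              span ((\<lambda>i. b i p) ` {..<k}) = span {e p})"
    using assms
    by (intro exI[of _ UNIV] exI[of _ "1::nat"] exI[of _ "\<lambda>i. e"]) (auto simp: lessThan_Suc)
qed

text \<open>A nonzero multiplier makes the image of the line the whole target line rather than just
  a subspace of it.\<close>

lemma invariant_field_span_singleton:
  assumes "\<And>p. linear (D p)" "\<And>p. D p (e p) = a p *\<^sub>R e (f p)" "\<And>p. a p \<noteq> (0::real)"
  shows "invariant_field f D (\<lambda>p. span {e p})"
  unfolding invariant_field_def
proof
  fix p
  have "D p ` span {e p} = span {a p *\<^sub>R e (f p)}"
    by (simp add: linear_span_image[OF assms(1), symmetric] assms(2))
  also have "\<dots> = span {e (f p)}"
  proof (intro span_eq[THEN iffD2] conjI)
    show "{a p *\<^sub>R e (f p)} \<subseteq> span {e (f p)}" by (simp add: span_base span_scale)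
    have "inverse (a p) *\<^sub>R (a p *\<^sub>R e (f p)) \<in> span {a p *\<^sub>R e (f p)}" by (intro span_scale span_base) simp
    then show "{e (f p)} \<subseteq> span {a p *\<^sub>R e (f p)}" using assms(3) by simp
  qed
  finally show "D p ` span {e p} = span {e (f p)}" .
qed

lemma dim_1_eq_span:
  fixes S :: "'a::euclidean_space set"
  assumes "subspace S" "dim S = 1" "x \<in> S" "x \<noteq> 0"
  shows "S = span {x}"
proof (rule subspace_dim_equal[symmetric])
  show "span {x} \<subseteq> S" using assms by (intro span_minimal) auto
qed (use assms in auto)

text \<open>The chain rule for \<open>inv f \<circ> f\<close>, combined with uniqueness of the
  derivative of the identity.\<close>

lemma torus_derivative_inv:
  assumes "torus_cover \<pi>" "torus_diffeo \<pi> f"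
  shows "torus_derivative \<pi> \<pi> (inv f) (f p) (torus_derivative \<pi> \<pi> f p v) = v"
proof -
  have "inv f \<circ> f = (\<lambda>p. p)" using assms(2) by (auto simp: torus_diffeo_def bij_def)
  moreover have "has_torus_derivative \<pi> \<pi> (inv f \<circ> f)
      (torus_derivative \<pi> \<pi> (inv f) (f p) \<circ> torus_derivative \<pi> \<pi> f p) p"
    using assms unfolding torus_diffeo_def
    by (auto intro: has_torus_derivative_compose[where \<rho> = \<pi>] torus_C1_has_torus_derivative)
  ultimately show ?thesis
    using has_torus_derivative_unique[OF assms(1,1) _ has_torus_derivative_id[OF assms(1)]]
    by (metis comp_apply)
qed

text \<open>The coefficients along the two graph lines are forced by the projection to the first
  factor; the height that remains is vertical.\<close>

lemma direct_sum3_graphs: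
  fixes u s :: "'v::real_vector" and \<phi> \<psi> :: real
  assumes span: "\<And>w. \<exists>\<xi> \<eta>. w = \<xi> *\<^sub>R s + \<eta> *\<^sub>R u"
    and indep: "\<And>\<xi> \<eta>. \<xi> *\<^sub>R s + \<eta> *\<^sub>R u = 0 \<Longrightarrow> \<xi> = 0 \<and> \<eta> = 0"
  shows "direct_sum3 (span {(u, \<phi>)}) (span {(0, 1)}) (span {(s, \<psi>)})"
  unfolding direct_sum3_def
proof (intro conjI allI subspace_span)
  fix v :: "'v \<times> real"
  obtain \<xi> \<eta> where \<xi>\<eta>: "fst v = \<xi> *\<^sub>R s + \<eta> *\<^sub>R u" using span by blast
  let ?w = "(\<eta> *\<^sub>R (u, \<phi>), (snd v - \<eta> * \<phi> - \<xi> * \<psi>) *\<^sub>R (0 :: 'v, 1 :: real), \<xi> *\<^sub>R (s, \<psi>))"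
  show "\<exists>!w. w \<in> span {(u, \<phi>)} \<times> span {(0, 1)} \<times> span {(s, \<psi>)} \<and> fst w + fst (snd w) + snd (snd w) = v"
  proof (rule ex1I[of _ ?w])
    show "?w \<in> span {(u, \<phi>)} \<times> span {(0, 1)} \<times> span {(s, \<psi>)} \<and> fst ?w + fst (snd ?w) + snd (snd ?w) = v"
      by (intro conjI SigmaI span_scale span_base) (auto simp: prod_eq_iff \<xi>\<eta>)
    fix w assume w: "w \<in> span {(u, \<phi>)} \<times> span {(0, 1)} \<times> span {(s, \<psi>)} \<and> fst w + fst (snd w) + snd (snd w) = v"
    then obtain a b c where abc: "w = (a *\<^sub>R (u, \<phi>), b *\<^sub>R (0, 1), c *\<^sub>R (s, \<psi>))"
      by (auto simp: span_singleton)
    then have v: "v = (a *\<^sub>R u + c *\<^sub>R s, a * \<phi> + b + c * \<psi>)" using w by auto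
    then have "(\<xi> - c) *\<^sub>R s + (\<eta> - a) *\<^sub>R u = 0" using \<xi>\<eta> by (simp add: algebra_simps)
    then have "c = \<xi>" "a = \<eta>" using indep[of "\<xi> - c" "\<eta> - a"] by auto
    then show "w = ?w" using abc v by simp
  qed
qed

lemma continuous_on_compose_UNIV:
  assumes "continuous_on UNIV f" "continuous_on UNIV h"
  shows "continuous_on UNIV (\<lambda>x. f (h x))"
  using continuous_on_compose2[OF assms] by simp

theorem proposition4p2:
  fixes A :: "torus2 \<Rightarrow> torus2"
    and g r :: "circle \<Rightarrow> circle"
    and EsA EuA :: "torus2 \<Rightarrow> (real \<times> real) set"
    and lamA c C \<beta> lam_max lam_min :: real
    and zr za :: circle
    and du ds :: "torus2 \<Rightarrow> real \<times> real"
    and \<alpha>u \<alpha>s :: "torus2 \<Rightarrow> real"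
    and F :: "torus3 \<Rightarrow> torus3"
  assumes A_C2: "torus_C2 proj2 proj2 A"
    and A_diffeo: "torus_diffeo proj2 A"
    and A_anosov: "anosov_splitting A EsA EuA lamA"
    and g_C2: "torus_C2 proj1 proj1 g"
    and g_diffeo: "torus_diffeo proj1 g"
    and g_pos: "\<And>z. circle_deriv g z > 0"
    and g_fix: "{z. g z = z} = {zr, za}" "zr \<noteq> za"
    and zr_repelling: "repelling_fixpoint g zr"
    and za_attracting: "attracting_fixpoint g za"
    and g_forward: "\<And>z. z \<notin> {za, zr} \<Longrightarrow> (\<lambda>n. (g ^^ n) z) \<longlonglongrightarrow> za"
    and g_backward: "\<And>z. z \<notin> {za, zr} \<Longrightarrow> (\<lambda>n. (inv g ^^ n) z) \<longlonglongrightarrow> zr"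
    and lam_max: "lam_max = circle_deriv g zr" "\<And>z. circle_deriv g z \<le> lam_max"
    and lam_min: "lam_min = circle_deriv g za" "\<And>z. lam_min \<le> circle_deriv g z"
    and r_diffeo: "torus_diffeo proj1 r"
    and r_orient: "\<And>x. circle_deriv r x > 0"
    and A1: "lamA < lam_min" "lam_min < 1" "1 < lam_max" "lam_max < inverse lamA"
    and A2: "torus_C2 proj1 proj1 r" "c > 0" "C > 0"
      "\<And>x. c \<le> circle_deriv r x" "\<And>x. circle_deriv r x \<le> C"
    and A3_transverse: "\<And>p. (0, 1) \<notin> EuA p" "\<And>p. (0, 1) \<notin> EsA p"
    and du: "\<And>p. du p \<in> EuA p" "\<And>p. norm (du p) = 1" "\<And>p. fst (du p) > 0"
    and ds: "\<And>p. ds p \<in> EsA p" "\<And>p. norm (ds p) = 1" "\<And>p. fst (ds p) < 0"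
    and A3_\<beta>: "\<beta> > 0" "\<And>p. du p \<bullet> (1, 0) \<ge> \<beta>" "\<And>p. ds p \<bullet> (1, 0) \<le> - \<beta>"
    and A3_\<alpha>: "\<And>p. D2 A p (du p) = \<alpha>u p *\<^sub>R du (A p)"
      "\<And>p. D2 A p (ds p) = \<alpha>s p *\<^sub>R ds (A p)"
      "\<And>p. \<alpha>u p > 0" "\<And>p. \<alpha>s p > 0"
    and F_def: "F = skew_product A g r"
  shows "\<exists>(Eu :: torus3 \<Rightarrow> ((real \<times> real) \<times> real) set) Ec Es c0.
    c0 > 0 \<and>
    (\<forall>q. direct_sum3 (Eu q) (Ec q) (Es q)) \<and>
    invariant_field F (D3 F) Eu \<and> invariant_field F (D3 F) Ec \<and> invariant_field F (D3 F) Es \<and>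
    continuous_subbundle Eu \<and> continuous_subbundle Ec \<and> continuous_subbundle Es \<and>
    (\<forall>q. Ec q = span {((0, 0), 1)}) \<and>
    (\<forall>q. \<forall>v\<in>Ec q. lam_min * norm v \<le> norm (D3 F q v) \<and>
                   norm (D3 F q v) \<le> lam_max * norm v) \<and>
    (\<forall>q. \<forall>v\<in>Eu q. \<forall>n. norm (D3 (F ^^ n) q v) \<ge> c0 * inverse lamA ^ n * norm v) \<and>
    (\<forall>q. \<forall>v\<in>Es q. \<forall>n. norm (D3 (F ^^ n) q v) \<le> inverse c0 * lamA ^ n * norm v)"
proof -

  \<comment> \<open>Regularity of the maps and range of the constants\<close>
  let ?G = "\<lambda>q :: torus3. circle_deriv g (snd q + r (fst (fst q)))"
  let ?R = "\<lambda>q :: torus3. circle_deriv r (fst (fst q))"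
  have A_C1: "torus_C1 proj2 proj2 A" "torus_C1 proj2 proj2 (inv A)"
    and g_C1: "torus_C1 proj1 proj1 g" "torus_C1 proj1 proj1 (inv g)"
    and r_C1: "torus_C1 proj1 proj1 r" and bij: "bij A" "bij g"
    using A_diffeo g_diffeo r_diffeo unfolding torus_diffeo_def by auto
  \<comment> \<open>Positivity is not part of \<open>anosov_splitting\<close>; it is forced by
    \<open>1 < lam_max < inverse lamA\<close>.\<close>
  have lamA: "0 < lamA" "lamA < 1"
  proof -
    have "0 < inverse lamA" using A1 by linarith
    then show "0 < lamA" by simp
    show "lamA < 1" using A1 by linarith
  qed
  have lam_min_pos: "0 < lam_min" using lam_min g_pos by simp
  have lin_A: "linear (D2 A p)" "linear (D2 (inv A) p)" for p
    using A_C1 linear_torus_derivative[OF torus_cover_proj2 torus_cover_proj2] by auto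

  \<comment> \<open>The base splitting and its multipliers\<close>
  have anosov: "direct_sum2 (EsA p) (EuA p)" "dim (EsA p) = 1" "dim (EuA p) = 1" for p
    using A_anosov unfolding anosov_splitting_def by blast+
  have ds_nz: "ds p \<noteq> 0" and du_nz: "du p \<noteq> 0" for p using ds(2)[of p] du(2)[of p] by auto
  have subspaces: "subspace (EsA p)" "subspace (EuA p)" for p
    using anosov(1)[of p] by (simp_all add: direct_sum2_def)
  have EsA: "EsA p = span {ds p}" and EuA: "EuA p = span {du p}" for p
    by (rule dim_1_eq_span[OF subspaces(1) anosov(2) ds(1) ds_nz],
        rule dim_1_eq_span[OF subspaces(2) anosov(3) du(1) du_nz])
  have basis: "\<exists>\<xi> \<eta>. w = \<xi> *\<^sub>R ds p + \<eta> *\<^sub>R du p" for p w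
  proof -
    obtain x where x: "x \<in> EsA p \<times> EuA p" "fst x + snd x = w"
      using anosov(1)[of p] unfolding direct_sum2_def by blast
    have "fst x \<in> range (\<lambda>k. k *\<^sub>R ds p)" "snd x \<in> range (\<lambda>k. k *\<^sub>R du p)"
      using x(1) by (simp_all only: mem_Times_iff EsA EuA span_singleton)
    then obtain \<xi> \<eta> where "fst x = \<xi> *\<^sub>R ds p" "snd x = \<eta> *\<^sub>R du p" by (elim rangeE)
    then show ?thesis using x(2) by (intro exI[of _ \<xi>] exI[of _ \<eta>]) simp
  qed
  have indep: "\<xi> = 0 \<and> \<eta> = 0" if "\<xi> *\<^sub>R ds p + \<eta> *\<^sub>R du p = 0" for \<xi> \<eta> p
  proof -
    have "\<exists>!w. w \<in> EsA p \<times> EuA p \<and> fst w + snd w = 0"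
      using anosov(1)[of p] unfolding direct_sum2_def by blast
    moreover have "(\<xi> *\<^sub>R ds p, \<eta> *\<^sub>R du p) \<in> EsA p \<times> EuA p" "(0, 0) \<in> EsA p \<times> EuA p"
      by (auto simp: EsA EuA span_scale span_base span_zero)
    ultimately have "(\<xi> *\<^sub>R ds p, \<eta> *\<^sub>R du p) = (0, 0)" using that by (metis fst_conv snd_conv add_0)
    then show ?thesis using ds_nz du_nz by simp
  qed
  have \<alpha>s: "\<alpha>s p \<le> lamA" for p
  proof -
    have "norm (D2 A p (ds p)) \<le> lamA * norm (ds p)"
      using A_anosov ds(1) unfolding anosov_splitting_def by blast
    then show ?thesis using A3_\<alpha>(4)[of p] by (simp add: A3_\<alpha>(2) ds(2))
  qed
  \<comment> \<open>The hypothesis on \<open>EuA\<close> speaks of \<open>inv A\<close>, so the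
    multiplier relations are transported to the inverse. They also exhibit \<open>du\<close> as the
    contracted direction of \<open>inv A\<close>.\<close>
  have inv_u: "D2 (inv A) (A p) (du (A p)) = inverse (\<alpha>u p) *\<^sub>R du p"
    and inv_s: "D2 (inv A) (A p) (ds (A p)) = inverse (\<alpha>s p) *\<^sub>R ds p" for p
  proof -
    have "\<alpha>u p *\<^sub>R D2 (inv A) (A p) (du (A p)) = du p" "\<alpha>s p *\<^sub>R D2 (inv A) (A p) (ds (A p)) = ds p"
      using torus_derivative_inv[OF torus_cover_proj2 A_diffeo, of p]
      by (simp_all add: A3_\<alpha>(1,2)[symmetric] linear_cmul[OF lin_A(2), symmetric])
    then have "inverse (\<alpha>u p) *\<^sub>R (\<alpha>u p *\<^sub>R D2 (inv A) (A p) (du (A p))) = inverse (\<alpha>u p) *\<^sub>R du p"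
      "inverse (\<alpha>s p) *\<^sub>R (\<alpha>s p *\<^sub>R D2 (inv A) (A p) (ds (A p))) = inverse (\<alpha>s p) *\<^sub>R ds p" by simp_all
    then show "D2 (inv A) (A p) (du (A p)) = inverse (\<alpha>u p) *\<^sub>R du p"
      "D2 (inv A) (A p) (ds (A p)) = inverse (\<alpha>s p) *\<^sub>R ds p"
      using A3_\<alpha>(3,4)[of p] by simp_all
  qed
  have \<alpha>u: "inverse (\<alpha>u p) \<le> lamA" for p
  proof -
    have "norm (D2 (inv A) (A p) (du (A p))) \<le> lamA * norm (du (A p))"
      using A_anosov du(1) unfolding anosov_splitting_def by blast
    then show ?thesis using A3_\<alpha>(3)[of p] by (simp add: inv_u du(2))
  qed
  have \<alpha>u': "inverse lamA \<le> \<alpha>u p" for p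
    using \<alpha>u[of p] A3_\<alpha>(3)[of p] lamA by (metis inverse_le_imp_le inverse_inverse_eq positive_imp_inverse_positive)
  have A_inv: "A (inv A p) = p" "inv A (A p) = p" "g (inv g z) = z" "inv g (g z) = z" for p z
    using bij by (simp_all add: bij_def surj_f_inv_f)
  have cont_A: "continuous_on UNIV A" "continuous_on UNIV (inv A)"
    and cont_g: "continuous_on UNIV g" "continuous_on UNIV (inv g)" and cont_r: "continuous_on UNIV r"
    using A_C1 g_C1 r_C1 torus_C1_continuous torus_cover_proj1 torus_cover_proj2 by blast+

  \<comment> \<open>Continuity of the base frame and of its multipliers\<close>
  have cont_ds: "continuous_on UNIV ds"
  \<comment> \<open>\<open>e = (-1, 0)\<close> matches the orientation of \<open>ds\<close> and so
    selects one of the two unit vectors of the line.\<close>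
  proof (rule continuous_contracted_direction[where D = "D2 A" and f = A and a = \<alpha>s and u = du and b = \<alpha>u
        and e = "(-1, 0)" and \<beta> = \<beta>, OF torus_cover_proj2])
    show "continuous_on UNIV (\<lambda>q. D2 A (fst q) (snd q))"
      by (rule continuous_on_torus_derivative[OF torus_cover_proj2 torus_cover_proj2 A_C1(1)])
    show "\<beta> \<le> ds p \<bullet> (-1, 0)" for p using A3_\<beta>(3)[of p] by (simp add: inner_prod_def)
    show "\<bar>\<alpha>s p\<bar> \<le> lamA" "inverse lamA \<le> \<bar>\<alpha>u p\<bar>" for p
      using \<alpha>s[of p] A3_\<alpha>(4)[of p] \<alpha>u'[of p] by auto
  qed (use cont_A lin_A lamA A3_\<alpha> ds(2) du(2) basis A3_\<beta>(1) in auto)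
  \<comment> \<open>For \<open>inv A\<close> the roles are exchanged: \<open>du\<close> is
    contracted and \<open>ds\<close> expanded, with reciprocal multipliers read at
    \<open>inv A p\<close>.\<close>
  have cont_du: "continuous_on UNIV du"
  proof (rule continuous_contracted_direction[where D = "D2 (inv A)" and f = "inv A"
        and a = "\<lambda>p. inverse (\<alpha>u (inv A p))" and u = ds and b = "\<lambda>p. inverse (\<alpha>s (inv A p))"
        and e = "(1, 0)" and \<beta> = \<beta>, OF torus_cover_proj2])
    show "continuous_on UNIV (\<lambda>q. D2 (inv A) (fst q) (snd q))"
      by (rule continuous_on_torus_derivative[OF torus_cover_proj2 torus_cover_proj2 A_C1(2)])
    show "D2 (inv A) p (du p) = inverse (\<alpha>u (inv A p)) *\<^sub>R du (inv A p)"
      "D2 (inv A) p (ds p) = inverse (\<alpha>s (inv A p)) *\<^sub>R ds (inv A p)" for p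
      using inv_u[of "inv A p"] inv_s[of "inv A p"] by (simp_all add: A_inv)
    show "\<bar>inverse (\<alpha>u (inv A p))\<bar> \<le> lamA" for p
      using \<alpha>u[of "inv A p"] A3_\<alpha>(3)[of "inv A p"] by simp
    show "inverse lamA \<le> \<bar>inverse (\<alpha>s (inv A p))\<bar>" for p
      using \<alpha>s[of "inv A p"] A3_\<alpha>(4)[of "inv A p"] by (simp add: le_imp_inverse_le)
    show "\<exists>\<xi> \<eta>. w = \<xi> *\<^sub>R du p + \<eta> *\<^sub>R ds p" for p w
      using basis[of w p] by (metis add.commute)
  qed (use cont_A lin_A lamA ds(2) du(2) A3_\<beta> in auto)
  have D2_cont: "continuous_on UNIV (\<lambda>p. D2 A p (w p))" if "continuous_on UNIV w" for w
    using continuous_on_compose2[OF continuous_on_torus_derivative[OF torus_cover_proj2 torus_cover_proj2 A_C1(1)],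
        of UNIV "\<lambda>p. (p, w p)"] that
    by (simp add: continuous_on_Pair continuous_on_id)
  \<comment> \<open>The frame vectors have norm one, so an inner product recovers the multipliers
    and passes continuity on to them.\<close>
  have "\<alpha>u = (\<lambda>p. D2 A p (du p) \<bullet> du (A p))" "\<alpha>s = (\<lambda>p. D2 A p (ds p) \<bullet> ds (A p))"
    using ds(2) du(2) by (simp_all add: A3_\<alpha> dot_square_norm)
  moreover have "continuous_on UNIV (\<lambda>p. D2 A p (du p) \<bullet> du (A p))"
    "continuous_on UNIV (\<lambda>p. D2 A p (ds p) \<bullet> ds (A p))"
    by (intro continuous_intros D2_cont cont_du cont_ds continuous_on_compose_UNIV[OF cont_du cont_A(1)]
        continuous_on_compose_UNIV[OF cont_ds cont_A(1)])+
  ultimately have cont_\<alpha>: "continuous_on UNIV \<alpha>u" "continuous_on UNIV \<alpha>s" by metis+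

  \<comment> \<open>The skew product, its inverse and its derivative\<close>
  have cont_coord: "continuous_on UNIV (\<lambda>q :: torus3. fst q)" "continuous_on UNIV (\<lambda>q :: torus3. fst (fst q))"
    "continuous_on UNIV (\<lambda>q :: torus3. snd q)"
    by (intro continuous_intros)+
  have cont_G: "continuous_on UNIV ?G" and cont_R: "continuous_on UNIV ?R"
    by (intro continuous_on_compose_UNIV[OF continuous_on_circle_deriv] g_C1 r_C1 continuous_on_circle_plus
        continuous_on_compose_UNIV[OF cont_r] cont_coord)+
  have F: "F q = (A (fst q), g (snd q + r (fst (fst q))))" for q
    by (simp add: F_def skew_product_def split: prod.splits)
  \<comment> \<open>The fibre map is undone from the outside in: first \<open>inv g\<close>, then
    subtraction of \<open>r\<close> at the base point preceding \<open>A\<close>.\<close>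
  define Finv where "Finv q = (inv A (fst q), inv g (snd q) - r (fst (inv A (fst q))))" for q :: torus3
  have Finv: "Finv (F q) = q" for q by (simp add: F Finv_def A_inv)
  have cont_F: "continuous_on UNIV F" "continuous_on UNIV Finv"
    unfolding F Finv_def
    by (intro continuous_on_Pair continuous_on_circle_plus continuous_on_circle_minus
        continuous_on_compose_UNIV[OF cont_A(1)] continuous_on_compose_UNIV[OF cont_A(2)]
        continuous_on_compose_UNIV[OF cont_g(1)] continuous_on_compose_UNIV[OF cont_g(2)]
        continuous_on_compose_UNIV[OF cont_r] continuous_on_fst cont_coord)+
  define DF where "DF q v = (D2 A (fst q) (fst v), ?G q * (snd v + ?R q * fst (fst v)))"
    for q and v :: "(real \<times> real) \<times> real"
  have has_DF: "has_torus_derivative proj3 proj3 F (DF q) q" for q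
    unfolding DF_def F_def by (rule has_torus_derivative_skew_product[OF A_C1(1) g_C1(1) r_C1])
  then have D3F: "D3 F q = DF q" for q
    by (rule torus_derivative_eq[OF torus_cover_proj3 torus_cover_proj3])
  have lin_DF: "linear (DF q)" for q
    using has_DF[of q] unfolding has_torus_derivative_def by (auto dest: has_derivative_linear)

  have G: "0 < ?G q" "lam_min \<le> ?G q" "?G q \<le> lam_max" for q using g_pos lam_min lam_max by auto
  have R: "\<bar>?R q\<bar> \<le> C" for q using A2(4,5)[of "fst (fst q)"] A2(2) by auto
  have fst_le: "\<bar>fst (du p)\<bar> \<le> 1" "\<bar>fst (ds p)\<bar> \<le> 1" for p
    using norm_fst_le[of "fst (du p)" "snd (du p)"] norm_fst_le[of "fst (ds p)" "snd (ds p)"] du(2) ds(2) by auto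

  \<comment> \<open>The graph function of the unstable direction\<close>
  let ?a = "\<lambda>q. ?G q / \<alpha>u (fst q)"
  have a: "\<bar>?a q\<bar> \<le> lam_max * lamA" for q
  proof -
    have "?G q * inverse (\<alpha>u (fst q)) \<le> lam_max * lamA"
      using G[of q] \<alpha>u[of "fst q"] A3_\<alpha>(3)[of "fst q"] A1 by (intro mult_mono) auto
    then show ?thesis using G(1)[of q] A3_\<alpha>(3)[of "fst q"] by (simp add: divide_inverse abs_mult)
  qed
  have ka: "lam_max * lamA < 1"
    using A1(4) lamA by (simp add: inverse_eq_divide pos_less_divide_eq)
  \<comment> \<open>The factor \<open>?a\<close> is estimated by \<open>1\<close>, the derivative of
    \<open>r\<close> by \<open>C\<close>, and the component of the unit vector \<open>du\<close> by
    \<open>1\<close>.\<close>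
  have b: "\<bar>?a q * (?R q * fst (du (fst q)))\<bar> \<le> 1 * (C * 1)" for q
    unfolding abs_mult[of "?a q"] abs_mult[of "?R q"] using a[of q] ka R[of q] fst_le(1) A2(3)
    by (intro mult_mono) auto
  have cont_a: "continuous_on UNIV ?a"
    using A3_\<alpha>(3) by (intro continuous_on_divide cont_G continuous_on_compose_UNIV[OF cont_\<alpha>(1)] cont_coord)
      (metis less_irrefl)
  have cont_b: "continuous_on UNIV (\<lambda>q. ?a q * (?R q * fst (du (fst q))))"
    by (intro continuous_on_mult cont_a cont_R continuous_on_fst continuous_on_compose_UNIV[OF cont_du] cont_coord)
  \<comment> \<open>Invariance determines \<open>\<phi>\<close> at \<open>F q\<close> from its value
    at \<open>q\<close>, so the shift is \<open>Finv\<close> and all coefficients are composed with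
    it. The contraction factor is \<open>lam_max * lamA\<close>.\<close>
  obtain \<phi> M where \<phi>: "continuous_on UNIV \<phi>" "\<And>q. \<bar>\<phi> q\<bar> \<le> M"
    and \<phi>_eq: "\<And>q. \<phi> q = ?a (Finv q) * \<phi> (Finv q) + ?a (Finv q) * (?R (Finv q) * fst (du (fst (Finv q))))"
    by (rule ex_bounded_continuous_twisted_equation[OF cont_F(2) continuous_on_compose_UNIV[OF cont_a cont_F(2)]
          continuous_on_compose_UNIV[OF cont_b cont_F(2)] a ka b]) (rule that)

  \<comment> \<open>The graph function of the stable direction\<close>
  let ?b = "\<lambda>q. \<alpha>s (fst q) / ?G q"
  have b': "\<bar>?b q\<bar> \<le> lamA / lam_min" for q
  proof -
    have "\<alpha>s (fst q) / ?G q \<le> lamA / lam_min"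
      using G[of q] \<alpha>s[of "fst q"] lam_min_pos lamA by (intro frac_le) auto
    then show ?thesis using G(1)[of q] A3_\<alpha>(4)[of "fst q"] by simp
  qed
  have kb: "lamA / lam_min < 1" using A1(1) lam_min_pos by simp
  have c': "\<bar>- (?R q * fst (ds (fst q)))\<bar> \<le> C * 1" for q
    unfolding abs_minus_cancel abs_mult using R[of q] fst_le(2) A2(3) by (intro mult_mono) auto
  have cont_b': "continuous_on UNIV ?b"
    using g_pos by (intro continuous_on_divide cont_G continuous_on_compose_UNIV[OF cont_\<alpha>(2)] cont_coord)
      (metis less_irrefl)
  have cont_c': "continuous_on UNIV (\<lambda>q. - (?R q * fst (ds (fst q))))"
    by (intro continuous_on_minus continuous_on_mult cont_R continuous_on_fst
        continuous_on_compose_UNIV[OF cont_ds] cont_coord)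
  \<comment> \<open>Here invariance is solved for the value at \<open>q\<close>, with shift
    \<open>F\<close>. Division by \<open>?G\<close> gives the contraction factor
    \<open>lamA / lam_min\<close> and clears \<open>?G\<close> from the inhomogeneous term.\<close>
  obtain \<psi> N where \<psi>: "continuous_on UNIV \<psi>" "\<And>q. \<bar>\<psi> q\<bar> \<le> N"
    and \<psi>_eq: "\<And>q. \<psi> q = ?b q * \<psi> (F q) + - (?R q * fst (ds (fst q)))"
    by (rule ex_bounded_continuous_twisted_equation[OF cont_F(1) cont_b' cont_c' b' kb c']) (rule that)

  \<comment> \<open>The invariant frame and its iterates\<close>
  define eu where "eu q = (du (fst q), \<phi> q)" for q
  define es where "es q = (ds (fst q), \<psi> q)" for q
  have DF_eu: "DF q (eu q) = \<alpha>u (fst q) *\<^sub>R eu (F q)" for q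
  proof -
    \<comment> \<open>The equation for \<open>\<phi>\<close> is taken at \<open>F q\<close>, where
      \<open>Finv\<close> leads back to \<open>q\<close>, and cleared of its denominator.\<close>
    have "\<alpha>u (fst q) * \<phi> (F q) = ?G q * (\<phi> q + ?R q * fst (du (fst q)))"
      using \<phi>_eq[of "F q"] A3_\<alpha>(3)[of "fst q"] by (simp add: Finv field_simps)
    then show ?thesis by (simp add: DF_def eu_def F A3_\<alpha>(1))
  qed
  have DF_es: "DF q (es q) = \<alpha>s (fst q) *\<^sub>R es (F q)" for q
  proof -
    have "?G q * (\<psi> q + ?R q * fst (ds (fst q))) = \<alpha>s (fst q) * \<psi> (F q)"
      using \<psi>_eq[of q] G(1)[of q] by simp
    then show ?thesis by (simp add: DF_def es_def F A3_\<alpha>(2))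
  qed
  have DF_ec: "DF q ((0, 0), t) = ((0, 0), ?G q * t)" for q t
    using linear_0[OF lin_A(1)] by (simp add: DF_def zero_prod_def)
  \<comment> \<open>The unit base components give the lower bounds. \<open>M\<close> and
    \<open>N\<close> bound absolute values and are thus nonnegative, so their sum serves both
    frames.\<close>
  have eu: "1 \<le> norm (eu q)" "norm (eu q) \<le> 1 + (M + N)" and es: "1 \<le> norm (es q)" "norm (es q) \<le> 1 + (M + N)"
    for q
    using norm_fst_le[of "du (fst q)" "\<phi> q"] norm_Pair_le[of "du (fst q)" "\<phi> q"] du(2)[of "fst q"] \<phi>(2)[of q]
      norm_fst_le[of "ds (fst q)" "\<psi> q"] norm_Pair_le[of "ds (fst q)" "\<psi> q"] ds(2)[of "fst q"] \<psi>(2)[of q]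
    unfolding eu_def es_def by auto
  have nz: "eu q \<noteq> 0" "es q \<noteq> 0" for q using eu(1)[of q] es(1)[of q] by auto
  define K where "K = 1 + (M + N)"
  \<comment> \<open>\<open>undefined\<close> stands for an arbitrary point of the torus; the two
    bounds at any point give the claim.\<close>
  have K: "1 \<le> K" using eu[of undefined] by (simp add: K_def)
  have D3_eu: "D3 (F ^^ n) q (t *\<^sub>R eu q) = (t * (\<Prod>i<n. \<alpha>u (fst ((F ^^ i) q)))) *\<^sub>R eu ((F ^^ n) q)"
    and D3_es: "D3 (F ^^ n) q (t *\<^sub>R es q) = (t * (\<Prod>i<n. \<alpha>s (fst ((F ^^ i) q)))) *\<^sub>R es ((F ^^ n) q)" for n q t
    using torus_derivative_funpow_eigenvector[of proj3 F DF eu "\<lambda>q. \<alpha>u (fst q)", OF torus_cover_proj3 has_DF lin_DF DF_eu]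
      torus_derivative_funpow_eigenvector[of proj3 F DF es "\<lambda>q. \<alpha>s (fst q)", OF torus_cover_proj3 has_DF lin_DF DF_es]
    by auto

  \<comment> \<open>Verification of the asserted properties\<close>
  show ?thesis
  proof (intro exI conjI allI ballI)
    \<comment> \<open>The constant \<open>c0\<close> is \<open>inverse K\<close>: frame vectors have
      norms between \<open>1\<close> and \<open>K\<close>, so passing from base to graph costs at
      most the factor \<open>K\<close>.\<close>
    show "0 < inverse K" using K by simp
    show "direct_sum3 (span {eu q}) (span {((0, 0), 1)}) (span {es q})" for q
      using direct_sum3_graphs[of "ds (fst q)" "du (fst q)" "\<phi> q" "\<psi> q", OF basis indep]
      by (simp add: eu_def es_def zero_prod_def)
    show "invariant_field F (D3 F) (\<lambda>q. span {eu q})"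
      unfolding D3F using A3_\<alpha>(3)
      by (intro invariant_field_span_singleton[of _ _ "\<lambda>q. \<alpha>u (fst q)"] lin_DF DF_eu) (metis less_irrefl)
    show "invariant_field F (D3 F) (\<lambda>q. span {es q})"
      unfolding D3F using A3_\<alpha>(4)
      by (intro invariant_field_span_singleton[of _ _ "\<lambda>q. \<alpha>s (fst q)"] lin_DF DF_es) (metis less_irrefl)
    show "invariant_field F (D3 F) (\<lambda>q. span {((0, 0), 1)})"
      unfolding D3F using g_pos
      by (intro invariant_field_span_singleton[of _ _ ?G] lin_DF) (auto simp: DF_ec, metis less_irrefl)
    show "continuous_subbundle (\<lambda>q. span {eu q})"
      by (rule continuous_subbundle_span_singleton[OF _ nz(1)]) (unfold eu_def,
        intro continuous_on_Pair \<phi> continuous_on_compose_UNIV[OF cont_du] cont_coord)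
    show "continuous_subbundle (\<lambda>q. span {es q})"
      by (rule continuous_subbundle_span_singleton[OF _ nz(2)]) (unfold es_def,
        intro continuous_on_Pair \<psi> continuous_on_compose_UNIV[OF cont_ds] cont_coord)
    show "continuous_subbundle (\<lambda>q :: torus3. span {((0 :: real, 0 :: real), 1 :: real)})"
      by (intro continuous_subbundle_span_singleton continuous_on_const) (simp add: prod_eq_iff)
    show "span {((0 :: real, 0 :: real), 1 :: real)} = span {((0, 0), 1)}" ..
  next
    fix q v assume "v \<in> span {((0 :: real, 0 :: real), 1 :: real)}"
    then obtain t where v: "v = ((0, 0), t)" by (auto simp: span_singleton)
    show "lam_min * norm v \<le> norm (D3 F q v)" "norm (D3 F q v) \<le> lam_max * norm v"
      using G[of q] by (auto simp: v D3F DF_ec norm_Pair abs_mult intro!: mult_right_mono)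
  next
    fix q v n assume "v \<in> span {eu q}"
    then obtain t where v: "v = t *\<^sub>R eu q" by (auto simp: span_singleton)
    let ?P = "\<Prod>i<n. \<alpha>u (fst ((F ^^ i) q))"
    have "(\<Prod>i<n. inverse lamA) \<le> ?P" using lamA \<alpha>u' by (intro prod_mono) auto
    then have P: "inverse lamA ^ n \<le> ?P" by simp
    \<comment> \<open>The initial frame vector has length at most \<open>K\<close>, which
      \<open>inverse K\<close> compensates; the final one has length at least
      \<open>1\<close>.\<close>
    have "inverse K * inverse lamA ^ n * norm v = inverse lamA ^ n * \<bar>t\<bar> * (norm (eu q) / K)"
      by (simp add: v divide_inverse)
    also have "\<dots> \<le> ?P * \<bar>t\<bar> * 1"
      using P eu(2)[of q] K lamA order_trans[OF _ P] by (intro mult_mono) (auto simp: K_def)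
    also have "\<dots> \<le> ?P * \<bar>t\<bar> * norm (eu ((F ^^ n) q))"
      using eu(1) order_trans[OF _ P, of 0] lamA by (intro mult_left_mono) auto
    also have "\<dots> = norm (D3 (F ^^ n) q v)"
      using order_trans[OF _ P, of 0] lamA by (simp add: v D3_eu abs_mult)
    finally show "inverse K * inverse lamA ^ n * norm v \<le> norm (D3 (F ^^ n) q v)" .
  next
    fix q v n assume "v \<in> span {es q}"
    then obtain t where v: "v = t *\<^sub>R es q" by (auto simp: span_singleton)
    let ?P = "\<Prod>i<n. \<alpha>s (fst ((F ^^ i) q))"
    have "?P \<le> (\<Prod>i<n. lamA)" by (intro prod_mono conjI less_imp_le[OF A3_\<alpha>(4)] \<alpha>s)
    then have P: "?P \<le> lamA ^ n" by simp
    have P0: "0 \<le> ?P" by (intro prod_nonneg ballI less_imp_le[OF A3_\<alpha>(4)])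
    \<comment> \<open>Now the final frame vector costs the factor \<open>K\<close>, and the initial
      one, of length at least \<open>1\<close>, allows \<open>|t|\<close> to be replaced by
      \<open>norm v\<close>.\<close>
    have "norm (D3 (F ^^ n) q v) = norm (es ((F ^^ n) q)) * ?P * \<bar>t\<bar>"
      using P0 by (simp add: v D3_es abs_mult)
    also have "\<dots> \<le> K * lamA ^ n * \<bar>t\<bar>"
      using P P0 es(2)[of "(F ^^ n) q"] K by (intro mult_mono) (auto simp: K_def)
    also have "\<dots> \<le> K * lamA ^ n * norm v"
      using es(1)[of q] K lamA by (intro mult_left_mono) (auto simp: v mult_le_cancel_left1)
    finally show "norm (D3 (F ^^ n) q v) \<le> inverse (inverse K) * lamA ^ n * norm v" by simp
  qed
qed

end
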